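(* Let $r\ge 2$ and let $\mathcal H$ be the Hecke algebra of $G(r,1,2)$ with its fixed reduced basis $B$. The vertices of the $\mathcal H$-double coset graph for $\langle t\rangle$-$\langle t\rangle$ double cosets are $\langle t\rangle 1\langle t\rangle$, $\langle t\rangle s\langle t\rangle$ and $\langle t\rangle st^as\langle t\rangle$ for $1\le a\le r-1$, and, apart from the loop at each vertex, its arrows are exactly $$\langle t\rangle st^as\langle t\rangle\longrightarrow\langle t\rangle s\langle t\rangle\qquad(2\le a\le r-1).$$ In particular the vertices $\langle t\rangle 1\langle t\rangle$, $\langle t\rangle s\langle t\rangle$ and $\langle t\rangle sts\langle t\rangle$ are terminal.
   Context: $G(r,1,2)=\langle s,t\mid s^2=t^r=1,\ stst=tsts\rangle$. Let $R=\mathbb Z[\xi_s,\xi_{t,1},\dots,\xi_{t,r-1}]$ be a polynomial ring in indeterminates. The Hecke algebra $\mathcal H$ of $G(r,1,2)$ is the $R$-algebra generated by $\tilde T_s,\tilde T_t$ subject to $\tilde T_s\tilde T_t\tilde T_s\tilde T_t=\tilde T_t\tilde T_s\tilde T_t\tilde T_s$, $\tilde T_s^2=1+\xi_s\tilde T_s$ and $\tilde T_t^r=1+\sum_{i=1}^{r-1}\xi_{t,i}\tilde T_t^{\,i}$. For a word $x_1\cdots x_k$ in $s,t$, $\tilde T_{x_1\cdots x_k}=\tilde T_{x_1}\cdots\tilde T_{x_k}$. $\mathcal H$ is free over $R$ with the fixed reduced basis $B$ consisting of $\tilde T_{t^a},\tilde T_{t^as}$ ($0\le a\le r-1$) and $\tilde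 T_{t^ast^b},\tilde T_{t^ast^bs}$ ($0\le a\le r-1$, $1\le b\le r-1$); it has exactly one element $\tilde T_{w,B}$ for each $w\in G(r,1,2)$. For $J\subseteq\{s,t\}$ let $W_J=\langle J\rangle$, let $\mathcal H_J$ be the subalgebra generated by $\tilde T_x$, $x\in J$, and for $d\in G(r,1,2)$ let $\mathcal H_{W_JdW_J}$ be the $R$-span of $\{\tilde T_{w,B}\mid w\in W_JdW_J\}$. The $\mathcal H$-double coset graph is the directed graph whose vertices are the double cosets $W_JdW_J$, represented by minimal length elements $d$, with an arrow $W_JdW_J\to W_Jd'W_J$ when some element of $\mathcal H_J\tilde T_{d,B}\mathcal H_J$, expanded in $B$, has a non-zero coefficient at some $\tilde T_{w,B}$ with $w\in W_Jd'W_J$. Every vertex has a loop; a vertex is terminal if it has no arrow to a different vertex. Here $J=\{t\}$ and the minimal length representatives used are $1,s,st^as$ ($1\le a\le r-1$). *)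

theory Defs
  imports
    "HOL-Algebra.Algebra"
    "HOL-Library.Poly_Mapping"
    "Graph_Theory.Pair_Digraph"
begin

section \<open>The group \<open>G(r,1,2)\<close>\<close>

datatype gen = gen_s | gen_t

text \<open>A signed word is a list of pairs \<open>(x, e)\<close>, where \<open>(x, True)\<close> stands for the generator \<open>x\<close>
  and \<open>(x, False)\<close> for its formal inverse.\<close>

type_synonym 'a signed_word = "('a \<times> bool) list"

definition pos_word :: "'a list \<Rightarrow> 'a signed_word"
  where "pos_word x = map (\<lambda>g. (g, True)) x"

inductive pres_cong :: "('a signed_word \<times> 'a signed_word) set \<Rightarrow> 'a signed_word \<Rightarrow> 'a signed_word \<Rightarrow> bool"
  for E where
  rel: "(u, v) \<in> E \<Longrightarrow> pres_cong E u v"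
| cancel: "pres_cong E [(x, e), (x, \<not> e)] []"
| refl: "pres_cong E u u"
| sym: "pres_cong E u v \<Longrightarrow> pres_cong E v u"
| trans: "pres_cong E u v \<Longrightarrow> pres_cong E v w \<Longrightarrow> pres_cong E u w"
| append: "pres_cong E u u' \<Longrightarrow> pres_cong E v v' \<Longrightarrow> pres_cong E (u @ v) (u' @ v')"

definition pres_class :: "('a signed_word \<times> 'a signed_word) set \<Rightarrow> 'a signed_word \<Rightarrow> 'a signed_word set"
  where "pres_class E u = {v. pres_cong E u v}"

definition presented_group :: "('a signed_word \<times> 'a signed_word) set \<Rightarrow> 'a signed_word set monoid"
  where "presented_group E =
    \<lparr>carrier = range (pres_class E),
     monoid.mult = (\<lambda>A B. \<Union>u\<in>A. \<Union>v\<in>B. pres_class E (u @ v)),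
     one = pres_class E []\<rparr>"

definition G_relations :: "nat \<Rightarrow> (gen signed_word \<times> gen signed_word) set"
  where "G_relations r =
    {(pos_word [gen_s, gen_s], pos_word []),
     (pos_word (replicate r gen_t), pos_word []),
     (pos_word [gen_s, gen_t, gen_s, gen_t], pos_word [gen_t, gen_s, gen_t, gen_s])}"

type_synonym gelem = "gen signed_word set"

definition Gr12 :: "nat \<Rightarrow> gelem monoid"
  where "Gr12 r = presented_group (G_relations r)"

definition elem_of_word :: "nat \<Rightarrow> gen list \<Rightarrow> gelem"
  where "elem_of_word r x = pres_class (G_relations r) (pos_word x)"

text \<open>Length with respect to the generators \<open>s\<close>, \<open>t\<close> themselves; \<open>t\<inverse>\<close> is not counted
  as a letter.\<close>

definition word_length :: "nat \<Rightarrow> gelem \<Rightarrow> nat"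
  where "word_length r w = (LEAST n. \<exists>x. length x = n \<and> elem_of_word r x = w)"

definition parabolic :: "nat \<Rightarrow> gen set \<Rightarrow> gelem set"
  where "parabolic r J = generate (Gr12 r) ((\<lambda>x. elem_of_word r [x]) ` J)"

definition double_coset :: "nat \<Rightarrow> gen set \<Rightarrow> gelem \<Rightarrow> gelem set"
  where "double_coset r J d = parabolic r J <#>\<^bsub>Gr12 r\<^esub> {d} <#>\<^bsub>Gr12 r\<^esub> parabolic r J"

definition min_length_elems :: "nat \<Rightarrow> gelem set \<Rightarrow> gelem set"
  where "min_length_elems r D = {d \<in> D. \<forall>w\<in>D. word_length r d \<le> word_length r w}"


section \<open>The Hecke algebra\<close>

text \<open>Polynomials with integer coefficients in variables indexed by \<^typ>\<open>nat\<close>. The variable with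
  index \<open>0\<close> is \<open>\<xi>\<^sub>s\<close>, the one with index \<open>i\<close>, for \<open>1 \<le> i \<le> r - 1\<close>, is \<open>\<xi>\<^sub>t\<^sub>,\<^sub>i\<close>; the ring \<open>R\<close> consists of
  the polynomials in which only these \<open>r\<close> variables occur.\<close>

type_synonym poly_xi = "(nat \<Rightarrow>\<^sub>0 nat) \<Rightarrow>\<^sub>0 int"

definition xi_s :: poly_xi
  where "xi_s = Poly_Mapping.single (Poly_Mapping.single 0 1) 1"

definition xi_t :: "nat \<Rightarrow> poly_xi"
  where "xi_t i = Poly_Mapping.single (Poly_Mapping.single i 1) 1"

definition coeff_ring :: "nat \<Rightarrow> poly_xi ring"
  where "coeff_ring r =
    \<lparr>carrier = {p. \<forall>m\<in>Poly_Mapping.keys p. Poly_Mapping.keys m \<subseteq> {..<r}},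
     monoid.mult = (*), one = 1, ring.zero = 0, add = (+)\<rparr>"

text \<open>Words with concatenation written additively, so that convolution of finitely supported
  functions on words is the multiplication of the free algebra on \<open>s\<close>, \<open>t\<close>.\<close>

datatype word = Word (letters: "gen list")

instantiation word :: monoid_add
begin

definition zero_word :: word
  where "0 = Word []"

definition plus_word :: "word \<Rightarrow> word \<Rightarrow> word"
  where "u + v = Word (letters u @ letters v)"

instance
  by standard (simp_all add: zero_word_def plus_word_def)

end

type_synonym free = "word \<Rightarrow>\<^sub>0 poly_xi"

definition free_algebra :: "nat \<Rightarrow> free ring"
  where "free_algebra r =
    \<lparr>carrier = {f. \<forall>w. Poly_Mapping.lookup f w \<in> carrier (coeff_ring r)},
     monoid.mult = (*), one = 1, ring.zero = 0, add = (+)\<rparr>"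

definition term_of :: "poly_xi \<Rightarrow> gen list \<Rightarrow> free"
  where "term_of c x = Poly_Mapping.single (Word x) c"

definition hecke_relators :: "nat \<Rightarrow> free set"
  where "hecke_relators r =
    {term_of 1 [gen_s, gen_t, gen_s, gen_t] - term_of 1 [gen_t, gen_s, gen_t, gen_s],
     term_of 1 [gen_s, gen_s] - (1 + term_of xi_s [gen_s]),
     term_of 1 (replicate r gen_t) - (1 + (\<Sum>i\<in>{1..r-1}. term_of (xi_t i) (replicate i gen_t)))}"

definition hecke_ideal :: "nat \<Rightarrow> free set"
  where "hecke_ideal r = Idl\<^bsub>free_algebra r\<^esub> (hecke_relators r)"

definition hecke_class :: "nat \<Rightarrow> free \<Rightarrow> free set"
  where "hecke_class r f = hecke_ideal r +>\<^bsub>free_algebra r\<^esub> f"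

definition hecke :: "nat \<Rightarrow> (poly_xi, free set) module"
  where "hecke r = (let Q = free_algebra r Quot hecke_ideal r in
    \<lparr>carrier = carrier Q, monoid.mult = monoid.mult Q, one = one Q,
     ring.zero = ring.zero Q, add = add Q,
     smult = (\<lambda>c h. hecke_class r (term_of c []) \<otimes>\<^bsub>Q\<^esub> h)\<rparr>)"

definition T_word :: "nat \<Rightarrow> gen list \<Rightarrow> free set"
  where "T_word r x = hecke_class r (term_of 1 x)"

definition basis_words :: "nat \<Rightarrow> gen list set"
  where "basis_words r =
    {replicate a gen_t | a. a < r} \<union>
    {replicate a gen_t @ [gen_s] | a. a < r} \<union>
    {replicate a gen_t @ [gen_s] @ replicate b gen_t | a b. a < r \<and> 1 \<le> b \<and> b < r} \<union>
    {replicate a gen_t @ [gen_s] @ replicate b gen_t @ [gen_s] | a b. a < r \<and> 1 \<le> b \<and> b < r}"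

definition T_basis :: "nat \<Rightarrow> gelem \<Rightarrow> free set"
  where "T_basis r w = T_word r (THE x. x \<in> basis_words r \<and> elem_of_word r x = w)"

text \<open>The \<open>R\<close>-subalgebra generated by the \<open>T\<^sub>x\<close>, \<open>x \<in> J\<close>: the subring generated by these and the
  scalars.\<close>

definition hecke_parabolic :: "nat \<Rightarrow> gen set \<Rightarrow> free set set"
  where "hecke_parabolic r J = generate_ring (hecke r)
    ((\<lambda>c. c \<odot>\<^bsub>hecke r\<^esub> \<one>\<^bsub>hecke r\<^esub>) ` carrier (coeff_ring r) \<union> (\<lambda>x. T_word r [x]) ` J)"

text \<open>The bimodule \<open>H\<^sub>J T\<^sub>d H\<^sub>J\<close>, i.e. all finite sums of products \<open>h T\<^sub>d h'\<close>.\<close>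

definition hecke_double :: "nat \<Rightarrow> gen set \<Rightarrow> gelem \<Rightarrow> free set set"
  where "hecke_double r J d = generate (add_monoid (hecke r))
    {h \<otimes>\<^bsub>hecke r\<^esub> T_basis r d \<otimes>\<^bsub>hecke r\<^esub> h' | h h'.
       h \<in> hecke_parabolic r J \<and> h' \<in> hecke_parabolic r J}"

definition expansion :: "nat \<Rightarrow> free set \<Rightarrow> (gelem \<Rightarrow> poly_xi) \<Rightarrow> bool"
  where "expansion r h c \<longleftrightarrow>
    c \<in> carrier (Gr12 r) \<rightarrow> carrier (coeff_ring r) \<and>
    h = (\<Oplus>\<^bsub>hecke r\<^esub>w\<in>carrier (Gr12 r). c w \<odot>\<^bsub>hecke r\<^esub> T_basis r w)"


section \<open>The double coset graph\<close>

text \<open>The expansion in \<open>B\<close> is unique because the \<open>T\<^sub>w\<^sub>,\<^sub>B\<close> form a basis, so quantifying over \<open>c\<close>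
  selects the coefficients of \<open>h\<close>. The representative \<open>d\<close> is any element of minimal length in its
  double coset.\<close>

definition dc_arrow :: "nat \<Rightarrow> gen set \<Rightarrow> gelem set \<Rightarrow> gelem set \<Rightarrow> bool"
  where "dc_arrow r J D D' \<longleftrightarrow>
    (\<exists>d \<in> min_length_elems r D. \<exists>h \<in> hecke_double r J d. \<exists>c.
       expansion r h c \<and> (\<exists>w\<in>D'. c w \<noteq> 0))"

definition dc_graph :: "nat \<Rightarrow> gen set \<Rightarrow> gelem set pair_pre_digraph"
  where "dc_graph r J = (let V = double_coset r J ` carrier (Gr12 r) in
    \<lparr>pverts = V, parcs = {(D, D'). D \<in> V \<and> D' \<in> V \<and> dc_arrow r J D D'}\<rparr>)"

definition terminal_vertex :: "'v pair_pre_digraph \<Rightarrow> 'v \<Rightarrow> bool"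
  where "terminal_vertex \<Gamma> v \<longleftrightarrow> v \<in> pverts \<Gamma> \<and> (\<forall>w. (v, w) \<in> parcs \<Gamma> \<longrightarrow> w = v)"

text \<open>The double coset of \<open>\<langle>t\<rangle>\<close> and \<open>\<langle>t\<rangle>\<close> represented by a positive word.\<close>

definition dc_t :: "nat \<Rightarrow> gen list \<Rightarrow> gelem set"
  where "dc_t r x = double_coset r {gen_t} (elem_of_word r x)"

definition st_pow_s :: "nat \<Rightarrow> gen list"
  where "st_pow_s a = [gen_s] @ replicate a gen_t @ [gen_s]"

end

theory Submission
  imports Defs
begin

text \<open>Double cosets and minimal lengths are read off from the action of \<open>G(r,1,2)\<close> on two copies of
  \<open>\<int>/r\<close>. In the Hecke algebra, \<open>T\<^sub>s T\<^sub>t T\<^sub>s\<close> commutes with \<open>T\<^sub>t\<close> and \<open>T\<^sub>s - \<xi>\<^sub>s\<close> is the inverse of \<open>T\<^sub>s\<close>, which gives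
  \<open>T\<^sub>s T\<^sub>t\<^sup>a T\<^sub>s T\<^sub>t = T\<^sub>t T\<^sub>s T\<^sub>t\<^sup>a T\<^sub>s - \<xi>\<^sub>s (T\<^sub>t T\<^sub>s T\<^sub>t\<^sup>a - T\<^sub>t\<^sup>a T\<^sub>s T\<^sub>t)\<close>. For \<open>a \<ge> 2\<close> the two terms in parentheses
  are different basis elements, hence the arrows to \<open>\<langle>t\<rangle>s\<langle>t\<rangle>\<close>. That there are no other arrows follows from
  explicit linear functionals on the Hecke algebra that pick out coefficients with respect to the
  basis. They come from the left action of \<open>T\<^sub>s\<close>, \<open>T\<^sub>t\<close> on \<open>C \<oplus> C\<close>, \<open>C = R[X, Y]/(f(X), f(Y))\<close> with
  \<open>f\<close> the polynomial of the relation for \<open>T\<^sub>t\<close>, given by \<open>s (p, q) = (q, p + \<xi>\<^sub>s q)\<close> and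
  \<open>t (p, q) = (Y p + \<xi>\<^sub>s (Y q(X, X) - X q), X q)\<close>; it is the left regular representation
  with \<open>(Y\<^sup>a X\<^sup>b, 0)\<close> in the place of \<open>T\<^sub>t\<^sup>a T\<^sub>s T\<^sub>t\<^sup>b\<close> and \<open>(0, Y\<^sup>a X\<^sup>b)\<close> in that of \<open>T\<^sub>s T\<^sub>t\<^sup>a T\<^sub>s T\<^sub>t\<^sup>b\<close>.\<close>

section \<open>Presented groups\<close>

lemma pres_class_eq_iff: "pres_class E u = pres_class E v \<longleftrightarrow> pres_cong E u v"
  unfolding pres_class_def by (auto intro: pres_cong.refl pres_cong.sym pres_cong.trans)

lemma presented_group_mult:
  "pres_class E u \<otimes>\<^bsub>presented_group E\<^esub> pres_class E v = pres_class E (u @ v)"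
proof -
  have "pres_class E (u' @ v') = pres_class E (u @ v)" if "pres_cong E u u'" "pres_cong E v v'" for u' v'
    using that by (simp add: pres_class_eq_iff pres_cong.append pres_cong.sym)
  then show ?thesis
    unfolding presented_group_def by (auto simp: pres_class_def intro: pres_cong.refl)
qed

lemma presented_group_carrier: "carrier (presented_group E) = range (pres_class E)"
  by (simp add: presented_group_def)

lemma presented_group_one: "\<one>\<^bsub>presented_group E\<^esub> = pres_class E []"
  by (simp add: presented_group_def)

lemma monoid_presented_group: "monoid (presented_group E)"
  by (rule monoidI)
    (auto simp: presented_group_carrier presented_group_one presented_group_mult)

section \<open>Normal forms in \<open>G(r,1,2)\<close>\<close>

abbreviation tpow :: "nat \<Rightarrow> gen list"
  where "tpow n \<equiv> replicate n gen_t"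

lemma tpow_add: "tpow (m + n) = tpow m @ tpow n"
  by (rule replicate_add)

lemma elem_eq_iff:
  "elem_of_word r x = elem_of_word r y \<longleftrightarrow> pres_cong (G_relations r) (pos_word x) (pos_word y)"
  by (simp add: elem_of_word_def pres_class_eq_iff)

lemma pos_word_append [simp]: "pos_word (x @ y) = pos_word x @ pos_word y"
  by (simp add: pos_word_def)

lemma elem_mult: "elem_of_word r x \<otimes>\<^bsub>Gr12 r\<^esub> elem_of_word r y = elem_of_word r (x @ y)"
  by (simp add: elem_of_word_def Gr12_def presented_group_mult)

lemma elem_append:
  "elem_of_word r x = elem_of_word r x' \<Longrightarrow> elem_of_word r y = elem_of_word r y' \<Longrightarrow>
    elem_of_word r (x @ y) = elem_of_word r (x' @ y')"
  by (metis elem_mult)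

lemma elem_context:
  "elem_of_word r x = elem_of_word r x' \<Longrightarrow> elem_of_word r (u @ x @ v) = elem_of_word r (u @ x' @ v)"
  by (intro elem_append HOL.refl)

lemma elem_ss: "elem_of_word r [gen_s, gen_s] = elem_of_word r []"
  unfolding elem_eq_iff by (rule pres_cong.rel) (simp add: G_relations_def)

lemma elem_tpow_r: "elem_of_word r (tpow r) = elem_of_word r []"
  unfolding elem_eq_iff by (rule pres_cong.rel) (simp add: G_relations_def)

lemma elem_braid:
  "elem_of_word r [gen_s, gen_t, gen_s, gen_t] = elem_of_word r [gen_t, gen_s, gen_t, gen_s]"
  unfolding elem_eq_iff by (rule pres_cong.rel) (simp add: G_relations_def)

lemma elem_tpow_mult: "elem_of_word r (tpow (n + r * k)) = elem_of_word r (tpow n)"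
proof (induction k)
  case (Suc k)
  have "elem_of_word r (tpow (n + r * Suc k)) = elem_of_word r (tpow (n + r * k) @ tpow r @ [])"
    by (simp flip: tpow_add add: algebra_simps)
  also have "\<dots> = elem_of_word r (tpow (n + r * k) @ [] @ [])"
    by (rule elem_context[OF elem_tpow_r])
  finally show ?case using Suc by simp
qed simp

lemma elem_tpow_mod: "elem_of_word r (tpow (n mod r)) = elem_of_word r (tpow n)"
  using elem_tpow_mult[of r "n mod r" "n div r"] by simp

text \<open>Because s is an involution, s t^(a+1) s = (s t^a s)(s t s). The braid relation says that
  s t s commutes with t, so every s t^a s does.\<close>

lemma elem_sts_commute1:
  "elem_of_word r ([gen_s] @ tpow a @ [gen_s, gen_t]) = elem_of_word r ([gen_t, gen_s] @ tpow a @ [gen_s])"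
proof (induction a)
  case 0
  then show ?case
    using elem_context[OF elem_ss, of r "[]" "[gen_t]"] elem_context[OF elem_ss, of r "[gen_t]" "[]"] by simp
next
  case (Suc a)
  let ?e = "elem_of_word r"
  have "?e ([gen_s] @ tpow (Suc a) @ [gen_s, gen_t])
      = ?e (([gen_s] @ tpow a) @ [] @ [gen_t, gen_s, gen_t])"
    by (simp add: replicate_append_same[symmetric])
  also have "\<dots> = ?e (([gen_s] @ tpow a) @ [gen_s, gen_s] @ [gen_t, gen_s, gen_t])"
    by (rule elem_context[OF elem_ss[symmetric]])
  also have "\<dots> = ?e (([gen_s] @ tpow a @ [gen_s]) @ [gen_s, gen_t, gen_s, gen_t] @ [])"
    by simp
  also have "\<dots> = ?e (([gen_s] @ tpow a @ [gen_s]) @ [gen_t, gen_s, gen_t, gen_s] @ [])"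
    by (rule elem_context[OF elem_braid])
  also have "\<dots> = ?e (([gen_s] @ tpow a @ [gen_s, gen_t]) @ [gen_s, gen_t, gen_s])"
    by simp
  also have "\<dots> = ?e (([gen_t, gen_s] @ tpow a @ [gen_s]) @ [gen_s, gen_t, gen_s])"
    by (rule elem_append[OF Suc HOL.refl])
  also have "\<dots> = ?e (([gen_t, gen_s] @ tpow a) @ [gen_s, gen_s] @ [gen_t, gen_s])"
    by simp
  also have "\<dots> = ?e (([gen_t, gen_s] @ tpow a) @ [] @ [gen_t, gen_s])"
    by (rule elem_context[OF elem_ss])
  also have "\<dots> = ?e ([gen_t, gen_s] @ tpow (Suc a) @ [gen_s])"
    by (simp add: replicate_append_same[symmetric])
  finally show ?case .
qed

lemma elem_sts_commute:
  "elem_of_word r ([gen_s] @ tpow a @ [gen_s] @ tpow b) = elem_of_word r (tpow b @ [gen_s] @ tpow a @ [gen_s])"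
proof (induction b)
  case (Suc b)
  let ?e = "elem_of_word r"
  have "?e ([gen_s] @ tpow a @ [gen_s] @ tpow (Suc b)) = ?e (([gen_s] @ tpow a @ [gen_s, gen_t]) @ tpow b)"
    by simp
  also have "\<dots> = ?e (([gen_t, gen_s] @ tpow a @ [gen_s]) @ tpow b)"
    by (rule elem_append[OF elem_sts_commute1 HOL.refl])
  also have "\<dots> = ?e ([gen_t] @ [gen_s] @ tpow a @ [gen_s] @ tpow b)"
    by simp
  also have "\<dots> = ?e ([gen_t] @ tpow b @ [gen_s] @ tpow a @ [gen_s])"
    by (rule elem_append[OF HOL.refl Suc])
  finally show ?case by simp
qed simp

text \<open>The two shapes are stable under left multiplication by both generators. For s this
  follows from the commutation s t^a s t^b = t^b s t^a s, which turns each shape into the other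
  one.\<close>

lemma elem_word_cases:
  "\<exists>a b. elem_of_word r x = elem_of_word r (tpow a @ [gen_s] @ tpow b @ [gen_s]) \<or>
         elem_of_word r x = elem_of_word r (tpow a @ [gen_s] @ tpow b)"
proof (induction x)
  case Nil
  then show ?case by (intro exI[of _ 0]) (simp add: elem_ss)
next
  case (Cons g x)
  let ?e = "elem_of_word r"
  from Cons obtain a b where ab: "?e x = ?e (tpow a @ [gen_s] @ tpow b @ [gen_s]) \<or>
         ?e x = ?e (tpow a @ [gen_s] @ tpow b)" by blast
  have Cons_cong: "?e (g # x) = ?e (g # y)" if "?e x = ?e y" for y
    using elem_append[OF HOL.refl that, of "[g]"] by simp
  show ?case
  proof (cases g)
    case gen_t
    have "?e (g # x) = ?e (tpow (Suc a) @ [gen_s] @ tpow b @ [gen_s]) \<or>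
        ?e (g # x) = ?e (tpow (Suc a) @ [gen_s] @ tpow b)"
      using ab Cons_cong[of "tpow a @ [gen_s] @ tpow b @ [gen_s]"] Cons_cong[of "tpow a @ [gen_s] @ tpow b"]
      unfolding gen_t replicate_Suc append_Cons by blast
    then show ?thesis by blast
  next
    case gen_s
    from ab show ?thesis
    proof
      assume "?e x = ?e (tpow a @ [gen_s] @ tpow b @ [gen_s])"
      then have "?e (g # x) = ?e (([gen_s] @ tpow a @ [gen_s] @ tpow b) @ [gen_s])"
        using Cons_cong[of "tpow a @ [gen_s] @ tpow b @ [gen_s]"] by (simp add: gen_s)
      also have "\<dots> = ?e ((tpow b @ [gen_s] @ tpow a @ [gen_s]) @ [gen_s])"
        by (rule elem_append[OF elem_sts_commute HOL.refl])
      also have "\<dots> = ?e ((tpow b @ [gen_s] @ tpow a) @ [gen_s, gen_s] @ [])" by simp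
      also have "\<dots> = ?e ((tpow b @ [gen_s] @ tpow a) @ [] @ [])"
        by (rule elem_context[OF elem_ss])
      finally show ?thesis by auto
    next
      assume "?e x = ?e (tpow a @ [gen_s] @ tpow b)"
      then have "?e (g # x) = ?e ([gen_s] @ tpow a @ [gen_s] @ tpow b)"
        using Cons_cong[of "tpow a @ [gen_s] @ tpow b"] by (simp add: gen_s)
      then show ?thesis using elem_sts_commute by metis
    qed
  qed
qed

lemma basis_words_eq:
  "basis_words r = {tpow a | a. a < r} \<union> {tpow a @ [gen_s] @ tpow b | a b. a < r \<and> b < r} \<union>
    {tpow a @ [gen_s] @ tpow b @ [gen_s] | a b. a < r \<and> 1 \<le> b \<and> b < r}"
proof -
  have "{tpow a @ [gen_s] @ tpow b | a b. a < r \<and> b < r} =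
     {tpow a @ [gen_s] | a. a < r} \<union> {tpow a @ [gen_s] @ tpow b | a b. a < r \<and> 1 \<le> b \<and> b < r}" (is "?L = ?R")
  proof
    show "?L \<subseteq> ?R"
    proof
      fix x assume "x \<in> ?L"
      then obtain a b where "x = tpow a @ [gen_s] @ tpow b" "a < r" "b < r" by blast
      then show "x \<in> ?R" by (cases b) auto
    qed
    have "\<exists>a' b'. tpow a @ [gen_s] = tpow a' @ [gen_s] @ tpow b' \<and> a' < r \<and> b' < r" if "a < r" for a
      using that by (intro exI[of _ a] exI[of _ 0]) auto
    then show "?R \<subseteq> ?L" by blast
  qed
  then show ?thesis unfolding basis_words_def by blast
qed

lemma elem_word_in_basis:
  assumes "0 < r"
  shows "elem_of_word r x \<in> elem_of_word r ` basis_words r"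
proof -
  let ?e = "elem_of_word r"
  obtain a b where ab: "?e x = ?e (tpow a @ [gen_s] @ tpow b @ [gen_s]) \<or>
         ?e x = ?e (tpow a @ [gen_s] @ tpow b)" using elem_word_cases by blast
  have lt: "a mod r < r" "b mod r < r" using assms by auto
  from ab show ?thesis
  proof
    assume "?e x = ?e (tpow a @ [gen_s] @ tpow b @ [gen_s])"
    then have e: "?e x = ?e (tpow (a mod r) @ [gen_s] @ tpow (b mod r) @ [gen_s])"
      by (simp only:) (intro elem_append elem_tpow_mod[symmetric] HOL.refl)
    show ?thesis
    proof (cases "b mod r = 0")
      case True
      have "?e (tpow (a mod r) @ [gen_s, gen_s] @ []) = ?e (tpow (a mod r) @ [] @ [])"
        by (rule elem_context[OF elem_ss])
      with e True have e': "?e x = ?e (tpow (a mod r))" by simp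
      from lt have "tpow (a mod r) \<in> basis_words r" unfolding basis_words_eq by blast
      then show ?thesis unfolding e' by (rule imageI)
    next
      case False
      with lt have "tpow (a mod r) @ [gen_s] @ tpow (b mod r) @ [gen_s] \<in> basis_words r"
        unfolding basis_words_eq
        by (intro UnI2 CollectI exI[of _ "a mod r"] exI[of _ "b mod r"]) auto
      then show ?thesis unfolding e by (rule imageI)
    qed
  next
    assume "?e x = ?e (tpow a @ [gen_s] @ tpow b)"
    then have e: "?e x = ?e (tpow (a mod r) @ [gen_s] @ tpow (b mod r))"
      by (simp only:) (intro elem_append elem_tpow_mod[symmetric] HOL.refl)
    from lt have "tpow (a mod r) @ [gen_s] @ tpow (b mod r) \<in> basis_words r"
      unfolding basis_words_eq by blast
    then show ?thesis unfolding e by (rule imageI)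
  qed
qed

text \<open>Formal inverses can be eliminated letter by letter: the inverse of s is s, and that of t
  is t^(r-1). Each is found by appending the trivial word \<open>g # x\<close> to the inverse of
  \<open>g\<close> and cancelling.\<close>

lemma pres_class_positive:
  assumes "0 < r"
  shows "\<exists>x. pres_class (G_relations r) u = elem_of_word r x"
proof -
  define E where "E = G_relations r"
  have cl: "pres_class E (u @ v) = pres_class E u \<otimes>\<^bsub>Gr12 r\<^esub> pres_class E v" for u v
    by (simp add: E_def Gr12_def presented_group_mult)
  have e: "elem_of_word r x = pres_class E (pos_word x)" for x by (simp add: elem_of_word_def E_def)
  have inv: "pres_class E [(g, False)] = pres_class E (pos_word x)"
    if "pres_class E (pos_word (g # x)) = pres_class E []" for g x
  proof -
    have "pres_class E [(g, False)] = pres_class E ([(g, False)] @ [])" by simp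
    also have "\<dots> = pres_class E ([(g, False)] @ pos_word (g # x))"
      by (simp only: cl that)
    also have "\<dots> = pres_class E ([(g, False), (g, \<not> False)] @ pos_word x)" by (simp add: pos_word_def)
    also have "\<dots> = pres_class E ([] @ pos_word x)"
      unfolding cl using pres_cong.cancel[of E g False] by (metis pres_class_eq_iff)
    finally show ?thesis by simp
  qed
  have "\<exists>x. pres_class E [ge] = pres_class E (pos_word x)" for ge
  proof -
    obtain g b where ge: "ge = (g, b)" by fastforce
    show ?thesis
    proof (cases b)
      case True
      then show ?thesis by (auto simp: ge pos_word_def intro!: exI[of _ "[g]"])
    next
      case False
      show ?thesis
      proof (cases g)
        case gen_s
        with inv[of gen_s "[gen_s]"] elem_ss[of r] False show ?thesis
          by (intro exI[of _ "[gen_s]"]) (simp add: e ge pos_word_def)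
      next
        case gen_t
        have "tpow r = gen_t # tpow (r - 1)" using assms by (cases r) auto
        with inv[of gen_t "tpow (r - 1)"] elem_tpow_r[of r] have "pres_class E [(gen_t, False)] = pres_class E (pos_word (tpow (r - 1)))"
          by (simp add: e pos_word_def)
        with False gen_t show ?thesis by (auto simp: ge)
      qed
    qed
  qed
  then have "\<exists>x. pres_class E u = pres_class E (pos_word x)"
  proof (induction u)
    case Nil
    then show ?case by (auto simp: pos_word_def intro!: exI[of _ "[]"])
  next
    case (Cons ge u)
    then obtain x y where "pres_class E [ge] = pres_class E (pos_word x)" "pres_class E u = pres_class E (pos_word y)" by meson
    then have "pres_class E (ge # u) = pres_class E (pos_word (x @ y))"
      using cl[of "[ge]" u] cl[of "pos_word x" "pos_word y"] by simp
    then show ?case by blast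
  qed
  then show ?thesis by (simp add: e E_def)
qed

lemma elem_in_carrier [simp]: "elem_of_word r x \<in> carrier (Gr12 r)"
  by (simp add: elem_of_word_def Gr12_def presented_group_carrier)

lemma carrier_Gr12: "0 < r \<Longrightarrow> carrier (Gr12 r) = elem_of_word r ` basis_words r"
  by (metis (no_types, opaque_lifting) Gr12_def elem_in_carrier elem_word_in_basis image_subset_iff
      presented_group_carrier pres_class_positive rangeE subsetI subset_antisym)

text \<open>\<open>G(r,1,2)\<close> acts on \<open>\<int>/r \<times> {True, False}\<close>, where \<open>t\<close> adds \<open>1\<close> on the first copy of \<open>\<int>/r\<close>
  and \<open>s\<close> swaps the copies. Working over \<open>\<int>\<close> instead lets the action count letters of positive
  words.\<close>

fun letter_act :: "gen \<times> bool \<Rightarrow> int \<times> bool \<Rightarrow> int \<times> bool"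
  where
    "letter_act (gen_s, e) (p, k) = (p, \<not> k)"
  | "letter_act (gen_t, e) (p, k) = (if k then if e then p + 1 else p - 1 else p, k)"

definition word_act :: "gen signed_word \<Rightarrow> int \<times> bool \<Rightarrow> int \<times> bool"
  where "word_act u = foldr letter_act u"

text \<open>Equality of points after reduction to \<int>/r. Of the three relations of the group,
  only t^r = 1 fails over the integers and has to be read modulo r.\<close>

definition agree :: "nat \<Rightarrow> int \<times> bool \<Rightarrow> int \<times> bool \<Rightarrow> bool"
  where "agree r x y \<longleftrightarrow> int r dvd fst x - fst y \<and> snd x = snd y"

lemma word_act_simps [simp]:
  "word_act [] x = x"
  "word_act (g # u) x = letter_act g (word_act u x)"
  "word_act (u @ v) x = word_act u (word_act v x)"
  by (simp_all add: word_act_def)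

lemma pos_word_simps [simp]:
  "pos_word [] = []"
  "pos_word (g # x) = (g, True) # pos_word x"
  by (simp_all add: pos_word_def)

lemma word_act_tpow [simp]: "word_act (pos_word (tpow n)) (p, k) = (if k then p + int n else p, k)"
  by (induction n) auto

lemma agree_refl: "agree r x x"
  and agree_sym: "agree r x y \<Longrightarrow> agree r y x"
  and agree_trans: "agree r x y \<Longrightarrow> agree r y z \<Longrightarrow> agree r x z"
  unfolding agree_def
  by (simp_all add: dvd_diff_commute) (metis diff_add_cancel add_diff_eq dvd_add)

lemma letter_act_agree: "agree r x y \<Longrightarrow> agree r (letter_act g x) (letter_act g y)"
  by (cases "(g, x)" rule: letter_act.cases; cases "(g, y)" rule: letter_act.cases)
    (auto simp: agree_def)

lemma word_act_agree: "agree r x y \<Longrightarrow> agree r (word_act u x) (word_act u y)"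
  by (induction u) (auto intro: letter_act_agree)

lemma pres_cong_agree:
  "pres_cong (G_relations r) u v \<Longrightarrow> agree r (word_act u x) (word_act v x)"
proof (induction arbitrary: x rule: pres_cong.induct)
  case (rel u v)
  obtain p k where "x = (p, k)" by fastforce
  with rel show ?case by (auto simp: G_relations_def agree_def)
next
  case (cancel g e)
  show ?case by (cases g; cases x) (auto simp: agree_def)
next
  case (append u u' v v')
  then show ?case
    unfolding word_act_simps by (metis agree_trans surj_pair word_act_agree)
next
  case (trans u v w)
  then show ?case by (metis agree_trans surj_pair)
qed (auto intro: agree_refl agree_sym)

lemma elem_agree:
  "elem_of_word r x = elem_of_word r y \<Longrightarrow> agree r (word_act (pos_word x) z) (word_act (pos_word y) z)"
  unfolding elem_eq_iff by (rule pres_cong_agree)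

lemma agree_less: "a < r \<Longrightarrow> b < r \<Longrightarrow> int r dvd int a - int b \<longleftrightarrow> a = b"
  by (metis eq_iff_diff_eq_0 dvd_0_right mod_eq_dvd_iff mod_less of_nat_eq_iff zmod_int)

text \<open>The images of the points 0 of the two copies determine a basis word. The word t^a sends
  them to a and 0 and t^a s t^b s sends them to a and b, both keeping the copies; t^a s t^b sends
  them to b and a and swaps the copies. The condition b \<ge> 1 separates t^a from t^a s t^b
  s.\<close>

lemma basis_words_agree:
  assumes "x \<in> basis_words r" "y \<in> basis_words r"
    and "\<And>k. agree r (word_act (pos_word x) (0, k)) (word_act (pos_word y) (0, k))"
  shows "x = y"
  using assms(1,2) assms(3)[of True] assms(3)[of False] agree_less[of _ r 0] agree_less[of 0 r]
  by (auto simp: basis_words_eq agree_def agree_less)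

lemma inj_on_basis_words: "inj_on (elem_of_word r) (basis_words r)"
  by (intro inj_onI basis_words_agree elem_agree)

text \<open>Faithfulness of the action, the converse of \<open>elem_agree\<close>: replace both
  words by basis words of the same elements and compare those.\<close>

lemma elem_eqI:
  assumes "0 < r" and "\<And>k. agree r (word_act (pos_word x) (0, k)) (word_act (pos_word y) (0, k))"
  shows "elem_of_word r x = elem_of_word r y"
proof -
  obtain x' y' where x': "x' \<in> basis_words r" "elem_of_word r x = elem_of_word r x'"
    and y': "y' \<in> basis_words r" "elem_of_word r y = elem_of_word r y'"
    using elem_word_in_basis[OF assms(1)] by (metis imageE)
  have "agree r (word_act (pos_word x') (0, k)) (word_act (pos_word y') (0, k))" for k
    using assms(2)[of k] elem_agree[OF x'(2)] elem_agree[OF y'(2)] by (meson agree_sym agree_trans)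
  with x' y' show ?thesis using basis_words_agree by metis
qed

lemma finite_basis_words: "finite (basis_words r)"
proof -
  have "basis_words r \<subseteq> tpow ` {..<r} \<union> (\<lambda>(a, b). tpow a @ [gen_s] @ tpow b) ` ({..<r} \<times> {..<r}) \<union>
     (\<lambda>(a, b). tpow a @ [gen_s] @ tpow b @ [gen_s]) ` ({..<r} \<times> {..<r})"
    by (auto simp: basis_words_eq)
  then show ?thesis by (rule finite_subset) auto
qed

section \<open>Double cosets of \<open>\<langle>t\<rangle>\<close> and minimal lengths\<close>

lemma monoid_Gr12: "monoid (Gr12 r)"
  unfolding Gr12_def by (rule monoid_presented_group)

lemma one_Gr12: "\<one>\<^bsub>Gr12 r\<^esub> = elem_of_word r []"
  by (simp add: Gr12_def presented_group_one elem_of_word_def)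

lemma inv_elem_t:
  assumes "0 < r"
  shows "inv\<^bsub>Gr12 r\<^esub> elem_of_word r [gen_t] = elem_of_word r (tpow (r - 1))"
proof -
  interpret monoid "Gr12 r" by (rule monoid_Gr12)
  have "[gen_t] @ tpow (r - 1) = tpow r" "tpow (r - 1) @ [gen_t] = tpow r"
    using assms by (cases r; simp add: replicate_append_same)+
  then show ?thesis
    by (intro inv_char) (simp_all add: elem_mult elem_tpow_r one_Gr12)
qed

lemma parabolic_t:
  assumes "0 < r"
  shows "parabolic r {gen_t} = range (\<lambda>i. elem_of_word r (tpow i))"
proof
  show "parabolic r {gen_t} \<subseteq> range (\<lambda>i. elem_of_word r (tpow i))"
  proof
    fix x assume "x \<in> parabolic r {gen_t}"
    then show "x \<in> range (\<lambda>i. elem_of_word r (tpow i))"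
      unfolding parabolic_def
    proof induction
      case one
      then show ?case by (auto simp: one_Gr12 intro!: image_eqI[of _ _ 0])
    next
      case (incl h)
      then show ?case by (auto intro!: image_eqI[of _ _ 1])
    next
      case (inv h)
      then show ?case by (auto simp: inv_elem_t[OF assms])
    next
      case (eng h1 h2)
      then show ?case by (auto simp: elem_mult simp flip: tpow_add)
    qed
  qed
  have "elem_of_word r (tpow i) \<in> parabolic r {gen_t}" for i
  proof (induction i)
    case 0
    then show ?case unfolding parabolic_def using generate.one[of "Gr12 r"] by (simp add: one_Gr12)
  next
    case (Suc i)
    have "elem_of_word r [gen_t] \<otimes>\<^bsub>Gr12 r\<^esub> elem_of_word r (tpow i) \<in> parabolic r {gen_t}"
      using Suc unfolding parabolic_def by (auto intro!: generate.eng intro: generate.incl)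
    then show ?case by (simp add: elem_mult)
  qed
  then show "range (\<lambda>i. elem_of_word r (tpow i)) \<subseteq> parabolic r {gen_t}" by auto
qed

lemma double_coset_t:
  assumes "0 < r"
  shows "double_coset r {gen_t} (elem_of_word r x) = {elem_of_word r (tpow i @ x @ tpow j) | i j. True}"
  unfolding double_coset_def parabolic_t[OF assms] set_mult_def
  by (auto simp: elem_mult) 

lemma double_coset_t_absorb:
  assumes "0 < r" and w: "w \<in> double_coset r {gen_t} (elem_of_word r x)"
  shows "double_coset r {gen_t} w = double_coset r {gen_t} (elem_of_word r x)"
proof -
  let ?e = "elem_of_word r"
  from w obtain a b where w: "w = ?e (tpow a @ x @ tpow b)"
    unfolding double_coset_t[OF assms(1)] by blast
  have *: "?e (tpow i @ (tpow a @ x @ tpow b) @ tpow j) = ?e (tpow (i + a) @ x @ tpow (b + j))" for i j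
    by (simp add: tpow_add)
  have "\<exists>i' j'. ?e (tpow i @ x @ tpow j) = ?e (tpow i' @ (tpow a @ x @ tpow b) @ tpow j')" for i j
  proof -
    \<comment> \<open>Adding multiples of r to the exponents leaves room to split off t^a and t^b;
      the surplus t^((r-1)a) plays the role of t^(-a).\<close>
    have "?e (tpow i @ x @ tpow j) = ?e (tpow (i + r * a) @ x @ tpow (j + r * b))"
      by (intro elem_append elem_tpow_mult[symmetric] HOL.refl)
    also have "\<dots> = ?e (tpow (i + (r - 1) * a) @ (tpow a @ x @ tpow b) @ tpow (j + (r - 1) * b))"
      unfolding * using assms(1) by (cases r) (simp_all add: algebra_simps)
    finally show ?thesis by blast
  qed
  then show ?thesis
    unfolding w double_coset_t[OF assms(1)] using * by blast
qed

section \<open>Letter counts and elements of minimal length\<close>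

lemma word_act_counts:
  "fst (word_act (pos_word x) (0, True)) \<ge> 0 \<and> fst (word_act (pos_word x) (0, False)) \<ge> 0 \<and>
   fst (word_act (pos_word x) (0, True)) + fst (word_act (pos_word x) (0, False)) = int (count_list x gen_t) \<and>
   snd (word_act (pos_word x) (0, True)) = even (count_list x gen_s) \<and>
   snd (word_act (pos_word x) (0, False)) = odd (count_list x gen_s)"
proof (induction x)
  case (Cons g x)
  \<comment> \<open>The two image points always lie in different copies. Hence each letter t raises
    exactly one of the two coordinates, and each s swaps the copies of both.\<close>
  then show ?case
    by (cases g; cases "word_act (pos_word x) (0, True)"; cases "word_act (pos_word x) (0, False)") auto
qed simp

lemma length_counts: "length x = count_list x gen_s + count_list x gen_t"
proof (induction x)
  case (Cons g x)
  then show ?case by (cases g) auto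
qed simp

lemma tpow_eqI: "count_list x gen_s = 0 \<Longrightarrow> x = tpow (length x)"
proof (induction x)
  case (Cons g x)
  then show ?case by (cases g) auto
qed simp

lemma dc_t_eq: "0 < r \<Longrightarrow> dc_t r y = {elem_of_word r (tpow i @ y @ tpow j) | i j. True}"
  by (simp add: dc_t_def double_coset_t)

lemma elem_in_dc_t: "0 < r \<Longrightarrow> elem_of_word r (tpow i @ y @ tpow j) \<in> dc_t r y"
  by (auto simp: dc_t_eq)

text \<open>Reduces minimality to statements about arbitrary words: every word for an element of the
  double coset is at least as long as \<open>y\<close>, and one of equal length represents the same
  element as \<open>y\<close>.\<close>

lemma min_length_elems_dc_t:
  assumes r: "0 < r"
    and le: "\<And>x i j. elem_of_word r x = elem_of_word r (tpow i @ y @ tpow j) \<Longrightarrow> length y \<le> length x"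
    and eq: "\<And>x i j. elem_of_word r x = elem_of_word r (tpow i @ y @ tpow j) \<Longrightarrow> length x = length y \<Longrightarrow>
      elem_of_word r x = elem_of_word r y"
  shows "min_length_elems r (dc_t r y) = {elem_of_word r y}"
proof -
  have ex: "\<exists>x. length x = word_length r (elem_of_word r z) \<and> elem_of_word r x = elem_of_word r z" for z
    unfolding word_length_def by (rule LeastI_ex) blast
  have up: "word_length r (elem_of_word r y) \<le> length y"
    unfolding word_length_def by (rule Least_le) blast
  have lo: "length y \<le> word_length r w" if "w \<in> dc_t r y" for w
    using that ex le unfolding dc_t_eq[OF r] by (clarsimp, metis)
  have y: "elem_of_word r y \<in> dc_t r y" using elem_in_dc_t[OF r, of 0 y 0] by simp
  have "w = elem_of_word r y" if w: "w \<in> dc_t r y" "word_length r w \<le> word_length r (elem_of_word r y)" for w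
  proof -
    obtain i j where ij: "w = elem_of_word r (tpow i @ y @ tpow j)" using w(1) by (auto simp: dc_t_eq[OF r])
    obtain x where x: "length x = word_length r w" "elem_of_word r x = w" using ex unfolding ij by blast
    have "length x = length y" using x(1) up w(2) lo[OF w(1)] by linarith
    with eq[of x i j] x ij show ?thesis by simp
  qed
  with y lo up show ?thesis unfolding min_length_elems_def by (auto intro: order.trans)
qed

lemma min_length_dc_t:
  assumes "0 < r" "x \<in> {[], [gen_s]} \<union> {st_pow_s a | a. 1 \<le> a \<and> a \<le> r - 1}"
  shows "min_length_elems r (dc_t r x) = {elem_of_word r x}"
  using assms(2)
proof (elim UnE insertE emptyE CollectE exE conjE)
  assume "x = []"
  then show ?thesis using min_length_elems_dc_t[OF assms(1), of "[]"] by simp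
next
  assume x: "x = [gen_s]"
  show ?thesis unfolding x
  proof (rule min_length_elems_dc_t[OF assms(1)])
    fix y i j assume "elem_of_word r y = elem_of_word r (tpow i @ [gen_s] @ tpow j)"
    from elem_agree[OF this, of "(0, True)"] have odd: "odd (count_list y gen_s)"
      using word_act_counts[of y] by (simp add: agree_def)
    then have "count_list y gen_s \<ge> 1" by (cases "count_list y gen_s") auto
    then show "length [gen_s] \<le> length y" using length_counts[of y] by simp
    show "elem_of_word r y = elem_of_word r [gen_s]" if "length y = length [gen_s]"
    proof -
      from that obtain g where "y = [g]" by (cases y) auto
      with odd show ?thesis by (cases g) auto
    qed
  qed
next
  fix a assume x: "x = st_pow_s a" and a: "1 \<le> a" "a \<le> r - 1"
  show ?thesis unfolding x
  proof (rule min_length_elems_dc_t[OF assms(1)])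
    fix y i j assume e: "elem_of_word r y = elem_of_word r (tpow i @ st_pow_s a @ tpow j)"
    \<comment> \<open>The coordinate \<open>q\<close> is an invariant of the double coset modulo r:
      the outer powers of t in t^i s t^a s t^j do not move the image of (0, False), which is (a,
      False). Since \<open>p\<close> and \<open>q\<close> are nonnegative and add up to the number
      of letters t, a lower bound for \<open>q\<close> bounds the length.\<close>
    define p q where "p = fst (word_act (pos_word y) (0, True))" and "q = fst (word_act (pos_word y) (0, False))"
    have q: "int r dvd q - int a" "even (count_list y gen_s)"
      using word_act_counts[of y] elem_agree[OF e, of "(0, False)"]
      by (simp_all add: agree_def st_pow_s_def q_def)
    have pq: "p \<ge> 0" "q \<ge> 0" "p + q = int (count_list y gen_t)"
      using word_act_counts[of y] by (simp_all add: p_def q_def)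
    have "q \<ge> int a"
    proof (rule ccontr)
      assume "\<not> q \<ge> int a"
      \<comment> \<open>A nonnegative \<open>q\<close> below a but congruent to a would force r
        \<le> a, contrary to a \<le> r - 1.\<close>
      with q(1) pq(2) have "int r \<le> int a - q" by (metis dvd_diff_commute zdvd_imp_le diff_gt_0_iff_gt not_le)
      with pq(2) a show False using assms(1) by linarith
    qed
    moreover have "count_list y gen_s \<noteq> 0"
    proof
      assume "count_list y gen_s = 0"
      then have "y = tpow (length y)" by (rule tpow_eqI)
      then have "word_act (pos_word y) (0, False) = (0, False)" by (metis word_act_tpow)
      with \<open>q \<ge> int a\<close> a show False by (simp add: q_def)
    qed
    with q(2) have s: "count_list y gen_s \<ge> 2" by presburger
    ultimately show le: "length (st_pow_s a) \<le> length y"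
      using pq length_counts[of y] by (simp add: st_pow_s_def)
    show "elem_of_word r y = elem_of_word r (st_pow_s a)" if len: "length y = length (st_pow_s a)"
    proof (rule elem_eqI[OF assms(1)])
      fix k
      \<comment> \<open>Equality of lengths leaves no slack in the bounds for letters t and letters
        s, so both image points are determined and faithfulness applies.\<close>
      have "q = int a" "p = 0" "count_list y gen_s = 2"
        using len s pq length_counts[of y] \<open>q \<ge> int a\<close> by (simp_all add: st_pow_s_def)
      then show "agree r (word_act (pos_word y) (0, k)) (word_act (pos_word (st_pow_s a)) (0, k))"
        using word_act_counts[of y] by (cases k) (auto simp: agree_def st_pow_s_def p_def q_def)
    qed
  qed
qed

section \<open>Separation and enumeration of the double cosets\<close>

lemma dc_t_cong: "0 < r \<Longrightarrow> w \<in> dc_t r x \<Longrightarrow> w \<in> dc_t r y \<Longrightarrow> dc_t r x = dc_t r y"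
  unfolding dc_t_def by (metis double_coset_t_absorb)

text \<open>The image of (0, False) separates them. It changes copy exactly for the double coset of
  s; otherwise its first coordinate modulo r is 0 for the identity and a for s t^a s.\<close>

lemma dc_t_distinct:
  assumes "0 < r"
  shows "dc_t r [] \<noteq> dc_t r [gen_s]"
    and "1 \<le> a \<Longrightarrow> a < r \<Longrightarrow> dc_t r [] \<noteq> dc_t r (st_pow_s a)"
    and "dc_t r [gen_s] \<noteq> dc_t r (st_pow_s a)"
    and "a < r \<Longrightarrow> b < r \<Longrightarrow> dc_t r (st_pow_s a) = dc_t r (st_pow_s b) \<Longrightarrow> a = b"
proof -
  have *: "agree r (word_act (pos_word x) (0, False)) (word_act (pos_word (tpow i @ y @ tpow j)) (0, False))"
    if "elem_of_word r x = elem_of_word r (tpow i @ y @ tpow j)" for x y i j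
    using that by (rule elem_agree)
  have ex: "\<exists>i j. elem_of_word r x = elem_of_word r (tpow i @ y @ tpow j)" if "dc_t r x = dc_t r y" for x y
    using that elem_in_dc_t[OF assms, of 0 x 0] unfolding dc_t_eq[OF assms, of y] by auto
  show "dc_t r [] \<noteq> dc_t r [gen_s]"
    using ex[of "[]" "[gen_s]"] *[of "[]" _ "[gen_s]"] by (auto simp: agree_def)
  show "dc_t r [gen_s] \<noteq> dc_t r (st_pow_s a)"
    using ex[of "[gen_s]" "st_pow_s a"] *[of "[gen_s]" _ "st_pow_s a"] by (auto simp: agree_def st_pow_s_def)
  show "dc_t r [] \<noteq> dc_t r (st_pow_s a)" if "1 \<le> a" "a < r"
    using that ex[of "[]" "st_pow_s a"] *[of "[]" _ "st_pow_s a"] agree_less[of 0 r a]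
    by (auto simp: agree_def st_pow_s_def)
  show "a = b" if "a < r" "b < r" "dc_t r (st_pow_s a) = dc_t r (st_pow_s b)"
    using that ex[of "st_pow_s a" "st_pow_s b"] *[of "st_pow_s a" _ "st_pow_s b"] agree_less[of a r b]
    by (auto simp: agree_def st_pow_s_def)
qed

lemma basis_word_dc_t:
  assumes "0 < r"
  shows "elem_of_word r (tpow a) \<in> dc_t r []"
    and "elem_of_word r (tpow a @ [gen_s] @ tpow b) \<in> dc_t r [gen_s]"
    and "elem_of_word r (tpow a @ [gen_s] @ tpow b @ [gen_s]) \<in> dc_t r (st_pow_s b)"
  using elem_in_dc_t[OF assms, of a "[]" 0] elem_in_dc_t[OF assms, of a "[gen_s]" b]
    elem_in_dc_t[OF assms, of a "st_pow_s b" 0] by (simp_all add: st_pow_s_def)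

lemma double_cosets_t:
  assumes "0 < r"
  shows "double_coset r {gen_t} ` carrier (Gr12 r) =
    {dc_t r [], dc_t r [gen_s]} \<union> {dc_t r (st_pow_s a) | a. 1 \<le> a \<and> a \<le> r - 1}"
proof
  have dc: "double_coset r {gen_t} w = dc_t r y" if "w \<in> dc_t r y" for w y
    using that double_coset_t_absorb[OF assms] by (simp add: dc_t_def)
  show "double_coset r {gen_t} ` carrier (Gr12 r) \<subseteq>
    {dc_t r [], dc_t r [gen_s]} \<union> {dc_t r (st_pow_s a) | a. 1 \<le> a \<and> a \<le> r - 1}" (is "_ \<subseteq> ?V")
  proof
    fix D assume "D \<in> double_coset r {gen_t} ` carrier (Gr12 r)"
    then obtain x where "x \<in> basis_words r" and D: "D = double_coset r {gen_t} (elem_of_word r x)"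
      unfolding carrier_Gr12[OF assms] by blast
    then consider a where "x = tpow a" | a b where "x = tpow a @ [gen_s] @ tpow b"
      | a b where "x = tpow a @ [gen_s] @ tpow b @ [gen_s]" "1 \<le> b" "b < r"
      unfolding basis_words_eq by blast
    then show "D \<in> ?V"
    proof cases
      case 3
      then have "D = dc_t r (st_pow_s b)" "b \<le> r - 1"
        unfolding D using dc[OF basis_word_dc_t(3)[OF assms]] by auto
      with 3 show ?thesis by blast
    qed (unfold D, use dc[OF basis_word_dc_t(1)[OF assms]] dc[OF basis_word_dc_t(2)[OF assms]] in auto)
  qed
qed (auto simp: dc_t_def)

lemma card_double_cosets_t:
  assumes "0 < r"
  shows "card (double_coset r {gen_t} ` carrier (Gr12 r)) = r + 1"
proof -
  have "{dc_t r (st_pow_s a) | a. 1 \<le> a \<and> a \<le> r - 1} = (\<lambda>a. dc_t r (st_pow_s a)) ` {1..r - 1}" by auto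
  moreover have "inj_on (\<lambda>a. dc_t r (st_pow_s a)) {1..r - 1}"
    using assms by (intro inj_onI dc_t_distinct(4)[OF assms]) auto
  moreover have "dc_t r [] \<noteq> dc_t r (st_pow_s a)" if "a \<in> {1..r - 1}" for a
    using that assms by (intro dc_t_distinct(2)) auto
  then have "dc_t r [] \<notin> (\<lambda>a. dc_t r (st_pow_s a)) ` {1..r - 1}" "dc_t r [gen_s] \<notin> (\<lambda>a. dc_t r (st_pow_s a)) ` {1..r - 1}"
    using dc_t_distinct(3)[OF assms] by blast+
  ultimately show ?thesis
    unfolding double_cosets_t[OF assms] using dc_t_distinct(1)[OF assms] assms
    by (simp add: card_image)
qed

section \<open>A representation of the Hecke algebra\<close>

text \<open>The transpose of the action on \<open>C \<oplus> C\<close>: the value of \<open>\<phi> e\<close> at \<open>i\<close>, \<open>j\<close> is that of a functional on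
  the monomial \<open>X\<^sup>i Y\<^sup>j\<close> of the first (\<open>e = False\<close>) or second (\<open>e = True\<close>) summand. Functionals on \<open>C\<close> are
  the functions that satisfy the recurrence of \<open>f\<close> in both arguments, and the transpose is a right
  action. \<open>base_value\<close> is the evaluation at \<open>(-\<xi>\<^sub>s, 1)\<close>, the vector in the place of \<open>1\<close>.\<close>

type_synonym rep = "bool \<Rightarrow> nat \<Rightarrow> nat \<Rightarrow> poly_xi"

definition s_rep :: "rep \<Rightarrow> rep"
  where "s_rep \<phi> = (\<lambda>e i j. if e then \<phi> False i j + xi_s * \<phi> True i j else \<phi> True i j)"

definition t_rep :: "rep \<Rightarrow> rep"
  where "t_rep \<phi> = (\<lambda>e i j. if e then xi_s * (\<phi> False (i + j) 1 - \<phi> False (i + 1) j) + \<phi> True (i + 1) j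
    else \<phi> False i (j + 1))"

definition letter_rep :: "gen \<Rightarrow> rep \<Rightarrow> rep"
  where "letter_rep g = (case g of gen_s \<Rightarrow> s_rep | gen_t \<Rightarrow> t_rep)"

definition word_rep :: "gen list \<Rightarrow> rep \<Rightarrow> rep"
  where "word_rep x = fold letter_rep x"

definition base_value :: "rep \<Rightarrow> poly_xi"
  where "base_value \<phi> = \<phi> True 0 0 - xi_s * \<phi> False 0 0"

lemma word_rep_simps [simp]:
  "word_rep [] \<phi> = \<phi>"
  "word_rep (gen_s # x) \<phi> = word_rep x (s_rep \<phi>)"
  "word_rep (gen_t # x) \<phi> = word_rep x (t_rep \<phi>)"
  "word_rep (x @ y) \<phi> = word_rep y (word_rep x \<phi>)"
  by (simp_all add: word_rep_def letter_rep_def)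

text \<open>This relation and the quadratic one hold for every \<open>\<phi>\<close>. The recurrence
  of f enters only for the relation of degree r.\<close>

lemma word_rep_braid: "word_rep [gen_s, gen_t, gen_s, gen_t] \<phi> = word_rep [gen_t, gen_s, gen_t, gen_s] \<phi>"
  by (intro ext) (simp add: s_rep_def t_rep_def algebra_simps)

lemma word_rep_quadratic: "word_rep [gen_s, gen_s] \<phi> e i j = \<phi> e i j + xi_s * word_rep [gen_s] \<phi> e i j"
  by (simp add: s_rep_def algebra_simps)

lemma word_rep_tpow_Suc: "word_rep (tpow (Suc n)) \<phi> = t_rep (word_rep (tpow n) \<phi>)"
  using word_rep_simps(4)[of "tpow n" "[gen_t]" \<phi>] by (simp only: replicate_append_same[symmetric] replicate_Suc word_rep_simps)

lemma word_rep_tpow_False: "word_rep (tpow n) \<phi> False i j = \<phi> False i (j + n)"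
proof (induction n arbitrary: j)
  case (Suc n)
  then show ?case by (simp only: word_rep_tpow_Suc) (simp add: t_rep_def)
qed simp

lemma word_rep_tpow_True_0:
  "word_rep (tpow n) \<phi> True i 0 = \<phi> True (i + n) 0 + xi_s * (\<phi> False i n - \<phi> False (i + n) 0)"
proof (induction n arbitrary: i)
  case (Suc n)
  show ?case
    by (simp only: word_rep_tpow_Suc) (simp add: t_rep_def word_rep_tpow_False Suc algebra_simps)
qed simp

text \<open>The correction made by one t on X^i Y^(j+1) is X^(i+j+1) Y - X^(i+1) Y^(j+1), that is X
  - Y times the sum of the X^(i+j-m) Y^(m+1) over m < j. Applying t altogether n times replaces the
  factor X - Y by X^n - Y^n. In the result each term has n added to a single argument.\<close>

lemma word_rep_tpow_True_Suc:
  "word_rep (tpow n) \<phi> True i (Suc j) = \<phi> True (i + n) (Suc j) +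
    xi_s * (\<Sum>m<j. \<phi> False (i + (j - m) + n) (Suc m) - \<phi> False (i + (j - m)) (Suc m + n))"
proof (induction n arbitrary: i)
  case (Suc n)
  define b where "b m = \<phi> False (Suc i + (j - m)) (Suc m + n)" for m
  have b: "b (Suc m) = \<phi> False (i + (j - m)) (Suc m + Suc n)" if "m < j" for m
    using that by (simp add: b_def Suc_diff_Suc)
  define S where "S = (\<Sum>m<j. \<phi> False (Suc i + (j - m) + n) (Suc m) - \<phi> False (Suc i + (j - m)) (Suc m + n))"
  \<comment> \<open>Passing from the sum for i + 1 and n to the one for i and n + 1 replaces
    \<open>b m\<close> by \<open>b (Suc m)\<close>. The difference telescopes to
    \<open>b 0 - b j\<close>, which is the contribution of the new letter t.\<close>
  have "S + (b 0 - b j) = (\<Sum>m<j. \<phi> False (Suc i + (j - m) + n) (Suc m) - b m) + (\<Sum>m<j. b m - b (Suc m))"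
    unfolding S_def b_def[of _, symmetric] sum_lessThan_telescope' ..
  also have "\<dots> = (\<Sum>m<j. \<phi> False (i + (j - m) + Suc n) (Suc m) - \<phi> False (i + (j - m)) (Suc m + Suc n))"
    unfolding sum.distrib[symmetric] by (intro sum.cong HOL.refl) (simp add: b)
  finally have S: "S + (b 0 - b j) = \<dots>" .
  have "word_rep (tpow (Suc n)) \<phi> True i (Suc j) = xi_s * (b 0 - b j) + word_rep (tpow n) \<phi> True (Suc i) (Suc j)"
    by (simp only: word_rep_tpow_Suc) (simp add: t_rep_def word_rep_tpow_False b_def)
  also have "\<dots> = \<phi> True (i + Suc n) (Suc j) + xi_s * (S + (b 0 - b j))"
    unfolding Suc S_def[symmetric] by (simp add: algebra_simps)
  finally show ?case unfolding S .
qed simp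

lemma base_value_tpow: "base_value (word_rep (tpow n) \<phi>) = \<phi> True n 0 - xi_s * \<phi> False n 0"
  by (simp add: base_value_def word_rep_tpow_False word_rep_tpow_True_0 algebra_simps)

text \<open>On vectors: t^j sends the base vector (-\<open>xi_s\<close>, 1) to (-\<open>xi_s\<close>
  X^j, X^j), then s gives (X^j, 0) and t^i gives (Y^i X^j, 0).\<close>

lemma base_value_t_s_t: "base_value (word_rep (tpow i @ [gen_s] @ tpow j) \<phi>) = \<phi> False j i"
  by (simp add: base_value_tpow s_rep_def word_rep_tpow_False)

lemma base_value_t_s_t_s_t:
  "base_value (word_rep (tpow i @ [gen_s] @ tpow a @ [gen_s] @ tpow j) \<phi>) = word_rep (tpow i) \<phi> True j a"
  by (simp add: base_value_tpow s_rep_def word_rep_tpow_False)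

section \<open>Sequences satisfying the linear recurrence with characteristic polynomial f\<close>

definition t_recurrent :: "nat \<Rightarrow> (nat \<Rightarrow> poly_xi) \<Rightarrow> bool"
  where "t_recurrent r u \<longleftrightarrow> (\<forall>n. u (r + n) = u n + (\<Sum>k\<in>{1..r-1}. xi_t k * u (k + n)))"

lemma t_recurrent_add: "t_recurrent r u \<Longrightarrow> t_recurrent r v \<Longrightarrow> t_recurrent r (\<lambda>n. u n + v n)"
  and t_recurrent_diff: "t_recurrent r u \<Longrightarrow> t_recurrent r v \<Longrightarrow> t_recurrent r (\<lambda>n. u n - v n)"
  and t_recurrent_mult: "t_recurrent r u \<Longrightarrow> t_recurrent r (\<lambda>n. c * u n)"
  and t_recurrent_zero: "t_recurrent r (\<lambda>n. 0)"
  by (simp_all add: t_recurrent_def algebra_simps sum.distrib sum_subtractf sum_distrib_left)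

lemma t_recurrent_mult': "t_recurrent r u \<Longrightarrow> t_recurrent r (\<lambda>n. u n * c)"
  using t_recurrent_mult[of r u c] by (simp add: mult.commute)

lemma t_recurrent_sum: "(\<And>k. k \<in> A \<Longrightarrow> t_recurrent r (u k)) \<Longrightarrow> t_recurrent r (\<lambda>n. \<Sum>k\<in>A. u k n)"
  by (induction A rule: infinite_finite_induct) (auto intro: t_recurrent_add t_recurrent_zero)

lemma t_recurrent_shift:
  assumes "t_recurrent r u"
  shows "t_recurrent r (\<lambda>n. u (n + m))" "t_recurrent r (\<lambda>n. u (m + n))" "t_recurrent r (\<lambda>n. u (Suc n))"
    "t_recurrent r (\<lambda>n. u (Suc (n + m)))" "t_recurrent r (\<lambda>n. u (Suc (m + n)))"
proof -
  have *: "t_recurrent r (\<lambda>n. u (n + m))" for m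
    using assms by (simp add: t_recurrent_def add.assoc)
  show "t_recurrent r (\<lambda>n. u (n + m))" "t_recurrent r (\<lambda>n. u (m + n))" "t_recurrent r (\<lambda>n. u (Suc n))"
    "t_recurrent r (\<lambda>n. u (Suc (n + m)))" "t_recurrent r (\<lambda>n. u (Suc (m + n)))"
    using *[of m] *[of 1] *[of "Suc m"] by (simp_all add: add.commute)
qed

definition rep_space :: "nat \<Rightarrow> rep set"
  where "rep_space r = {\<phi>. \<forall>e k. t_recurrent r (\<lambda>n. \<phi> e n k) \<and> t_recurrent r (\<phi> e k)}"

lemma rep_spaceD:
  "\<phi> \<in> rep_space r \<Longrightarrow> t_recurrent r (\<lambda>n. \<phi> e n k)" "\<phi> \<in> rep_space r \<Longrightarrow> t_recurrent r (\<lambda>n. \<phi> e k n)"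
  by (simp_all add: rep_space_def)

lemma s_rep_closed:
  assumes "\<phi> \<in> rep_space r"
  shows "s_rep \<phi> \<in> rep_space r"
proof -
  note D = rep_spaceD[OF assms]
  have "t_recurrent r (\<lambda>n. s_rep \<phi> e n k)" "t_recurrent r (s_rep \<phi> e k)" for e k
    using D by (cases e; auto simp: s_rep_def intro!: t_recurrent_add t_recurrent_mult)+
  then show ?thesis by (simp add: rep_space_def)
qed

lemma t_rep_closed:
  assumes "\<phi> \<in> rep_space r"
  shows "t_rep \<phi> \<in> rep_space r"
proof -
  note D = rep_spaceD[OF assms]
  have "t_recurrent r (\<lambda>n. t_rep \<phi> e n k)" for e k
    using D by (cases e) (auto simp: t_rep_def intro!: t_recurrent_add t_recurrent_mult t_recurrent_diff D[THEN t_recurrent_shift(1)] D[THEN t_recurrent_shift(3)])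
  moreover have "t_recurrent r (t_rep \<phi> e k)" for e k
    using D by (cases e) (auto simp: t_rep_def intro!: t_recurrent_add t_recurrent_mult t_recurrent_diff D[THEN t_recurrent_shift(2)] D[THEN t_recurrent_shift(3)])
  ultimately show ?thesis by (simp add: rep_space_def)
qed

lemma word_rep_closed: "\<phi> \<in> rep_space r \<Longrightarrow> word_rep x \<phi> \<in> rep_space r"
proof (induction x arbitrary: \<phi>)
  case (Cons g x)
  then show ?case by (cases g) (simp_all add: s_rep_closed t_rep_closed)
qed simp

text \<open>In the closed forms for the action of t^n the number n only shifts single arguments of
  \<open>\<phi>\<close>, so the recurrence passes to the exponent n. Its instance at 0 is the
  relation of degree r.\<close>

lemma word_rep_tpow_recurrent:
  assumes "\<phi> \<in> rep_space r"
  shows "t_recurrent r (\<lambda>n. word_rep (tpow n) \<phi> e i j)"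
proof -
  note D = rep_spaceD[OF assms]
  note D' = D[THEN t_recurrent_shift(2)] D[THEN t_recurrent_shift(5)]
  show ?thesis
  proof (cases e)
    case True
    show ?thesis
      by (cases j; simp only: True word_rep_tpow_True_0 word_rep_tpow_True_Suc)
        (intro t_recurrent_add t_recurrent_mult t_recurrent_diff t_recurrent_sum D D')+
  next
    case False
    then show ?thesis using D' by (simp add: word_rep_tpow_False)
  qed
qed

lemma word_rep_tpow_r:
  assumes "\<phi> \<in> rep_space r"
  shows "word_rep (tpow r) \<phi> e i j = \<phi> e i j + (\<Sum>k\<in>{1..r-1}. xi_t k * word_rep (tpow k) \<phi> e i j)"
  using word_rep_tpow_recurrent[OF assms, of e i j] unfolding t_recurrent_def by (metis (no_types, lifting) add_0_right replicate_0 word_rep_simps(1) sum.cong)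

lemma word_rep_sum:
  "word_rep x (\<lambda>e i j. \<Sum>k\<in>A. c k * \<phi> k e i j) = (\<lambda>e i j. \<Sum>k\<in>A. c k * word_rep x (\<phi> k) e i j)"
proof (induction x arbitrary: \<phi>)
  case (Cons g x)
  have s: "s_rep (\<lambda>e i j. \<Sum>k\<in>A. c k * \<phi> k e i j) = (\<lambda>e i j. \<Sum>k\<in>A. c k * s_rep (\<phi> k) e i j)"
    by (intro ext) (simp add: s_rep_def algebra_simps sum.distrib sum_distrib_left)
  have t: "t_rep (\<lambda>e i j. \<Sum>k\<in>A. c k * \<phi> k e i j) = (\<lambda>e i j. \<Sum>k\<in>A. c k * t_rep (\<phi> k) e i j)"
    by (intro ext) (simp add: t_rep_def algebra_simps sum.distrib sum_subtractf sum_distrib_left)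
  show ?case by (cases g) (simp_all add: s t Cons)
qed simp

section \<open>Linear extension of the action to the free algebra\<close>

definition free_rep :: "free \<Rightarrow> rep \<Rightarrow> rep"
  where "free_rep F \<phi> = (\<lambda>e i j. \<Sum>w\<in>Poly_Mapping.keys F. Poly_Mapping.lookup F w * word_rep (letters w) \<phi> e i j)"

lemma free_rep_superset:
  assumes "finite A" "Poly_Mapping.keys F \<subseteq> A"
  shows "free_rep F \<phi> e i j = (\<Sum>w\<in>A. Poly_Mapping.lookup F w * word_rep (letters w) \<phi> e i j)"
  unfolding free_rep_def using assms by (intro sum.mono_neutral_left) (auto simp: in_keys_iff)

lemma free_rep_add: "free_rep (F + G) \<phi> e i j = free_rep F \<phi> e i j + free_rep G \<phi> e i j"
proof -
  let ?A = "Poly_Mapping.keys F \<union> Poly_Mapping.keys G"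
  have "Poly_Mapping.keys (F + G) \<subseteq> ?A" by (rule keys_add)
  then show ?thesis
    by (simp add: free_rep_superset[of ?A] lookup_add distrib_right sum.distrib)
qed

lemma free_rep_zero [simp]: "free_rep 0 \<phi> e i j = 0"
  by (simp add: free_rep_def)

lemma free_rep_diff: "free_rep (F - G) \<phi> e i j = free_rep F \<phi> e i j - free_rep G \<phi> e i j"
  using free_rep_add[of "F - G" G \<phi> e i j] by simp

lemma free_rep_sum: "free_rep (\<Sum>k\<in>A. F k) \<phi> e i j = (\<Sum>k\<in>A. free_rep (F k) \<phi> e i j)"
  by (induction A rule: infinite_finite_induct) (simp_all add: free_rep_add)

lemma free_rep_term_of: "free_rep (term_of c x) \<phi> e i j = c * word_rep x \<phi> e i j"
  by (subst free_rep_superset[of "{Word x}"]) (auto simp: term_of_def)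

lemma term_of_mult: "term_of c x * term_of d y = term_of (c * d) (x @ y)"
  by (simp add: term_of_def mult_single plus_word_def)

lemma one_free: "(1 :: free) = term_of 1 []"
  by (simp add: term_of_def flip: zero_word_def single_one)

lemma free_expand: "(F :: free) = (\<Sum>w\<in>Poly_Mapping.keys F. term_of (Poly_Mapping.lookup F w) (letters w))"
  by (rule poly_mapping_eqI)
    (simp add: lookup_sum term_of_def lookup_single when_def sum.delta in_keys_iff)

text \<open>The left factor acts first, as befits a right action. Linearity of each word in
  \<open>\<phi>\<close> allows the two sums to be interchanged.\<close>

lemma free_rep_mult: "free_rep (F * G) \<phi> = free_rep G (free_rep F \<phi>)"
proof (intro ext)
  fix e i j
  have "F * G = (\<Sum>v\<in>Poly_Mapping.keys F. \<Sum>w\<in>Poly_Mapping.keys G.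
      term_of (Poly_Mapping.lookup F v * Poly_Mapping.lookup G w) (letters v @ letters w))"
    by (subst free_expand[of F], subst free_expand[of G]) (simp add: sum_product term_of_mult)
  then have "free_rep (F * G) \<phi> e i j = (\<Sum>v\<in>Poly_Mapping.keys F. \<Sum>w\<in>Poly_Mapping.keys G.
      Poly_Mapping.lookup G w * (Poly_Mapping.lookup F v * word_rep (letters w) (word_rep (letters v) \<phi>) e i j))"
    by (simp add: free_rep_sum free_rep_term_of algebra_simps)
  also have "\<dots> = (\<Sum>w\<in>Poly_Mapping.keys G. \<Sum>v\<in>Poly_Mapping.keys F.
      Poly_Mapping.lookup G w * (Poly_Mapping.lookup F v * word_rep (letters w) (word_rep (letters v) \<phi>) e i j))"
    by (rule sum.swap)
  also have "\<dots> = free_rep G (free_rep F \<phi>) e i j"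
    unfolding free_rep_def[of G] unfolding free_rep_def by (simp add: word_rep_sum sum_distrib_left)
  finally show "free_rep (F * G) \<phi> e i j = free_rep G (free_rep F \<phi>) e i j" .
qed

lemma free_rep_closed:
  assumes "\<phi> \<in> rep_space r"
  shows "free_rep F \<phi> \<in> rep_space r"
  using rep_spaceD[OF word_rep_closed[OF assms]] unfolding rep_space_def free_rep_def
  by (auto intro!: t_recurrent_sum t_recurrent_mult)

lemma free_rep_of_zero: "free_rep F (\<lambda>e i j. 0) = (\<lambda>e i j. 0)"
  using word_rep_sum[where A = "{}"] by (simp add: free_rep_def)

lemma free_rep_relator:
  assumes "\<phi> \<in> rep_space r" "F \<in> hecke_relators r"
  shows "free_rep F \<phi> e i j = 0"
proof -
  have one: "free_rep 1 \<phi> e i j = \<phi> e i j" by (simp add: one_free free_rep_term_of)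
  from assms(2) consider "F = term_of 1 [gen_s, gen_t, gen_s, gen_t] - term_of 1 [gen_t, gen_s, gen_t, gen_s]"
    | "F = term_of 1 [gen_s, gen_s] - (1 + term_of xi_s [gen_s])"
    | "F = term_of 1 (tpow r) - (1 + (\<Sum>i\<in>{1..r-1}. term_of (xi_t i) (tpow i)))"
    unfolding hecke_relators_def by blast
  then show ?thesis
  proof cases
    case 1
    then show ?thesis by (simp only: free_rep_diff free_rep_term_of word_rep_braid) simp
  next
    case 2
    then show ?thesis
      by (simp only: free_rep_diff free_rep_add free_rep_term_of word_rep_quadratic one) simp
  next
    case 3
    then show ?thesis
      by (simp only: free_rep_diff free_rep_add free_rep_term_of free_rep_sum word_rep_tpow_r[OF assms(1)] one) simp
  qed
qed

text \<open>For k < r this is the coefficient of X^k in the remainder of X^n modulo f, so these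
  sequences form the basis dual to 1, X, ..., X^(r-1). The case r = 0 counts as initial because n -
  r would not decrease there.\<close>

function unit_seq :: "nat \<Rightarrow> nat \<Rightarrow> nat \<Rightarrow> poly_xi"
  where "unit_seq r k n = (if n < r \<or> r = 0 then if n = k then 1 else 0
    else unit_seq r k (n - r) + (\<Sum>i\<in>{1..r-1}. xi_t i * unit_seq r k (i + (n - r))))"
  by pat_completeness auto
termination
  by (relation "Wellfounded.measure (\<lambda>(r, k, n). n)") auto

declare unit_seq.simps [simp del]

lemma unit_seq_less: "n < r \<Longrightarrow> unit_seq r k n = (if n = k then 1 else 0)"
  by (simp add: unit_seq.simps)

lemma unit_seq_recurrent: "0 < r \<Longrightarrow> t_recurrent r (unit_seq r k)"
  unfolding t_recurrent_def by (subst unit_seq.simps) simp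

section \<open>The Hecke algebra as a quotient of the free algebra\<close>

abbreviation xi_polys :: "nat \<Rightarrow> poly_xi set"
  where "xi_polys r \<equiv> carrier (coeff_ring r)"

lemma xi_polys_eq: "xi_polys r = {p. \<forall>m\<in>Poly_Mapping.keys p. Poly_Mapping.keys m \<subseteq> {..<r}}"
  by (simp add: coeff_ring_def)

lemma xi_polys_0 [simp]: "0 \<in> xi_polys r" and xi_polys_1 [simp]: "1 \<in> xi_polys r"
  by (auto simp: xi_polys_eq)

lemma xi_polys_add: "p \<in> xi_polys r \<Longrightarrow> q \<in> xi_polys r \<Longrightarrow> p + q \<in> xi_polys r"
  using keys_add[of p q] unfolding xi_polys_eq by blast

lemma xi_polys_uminus: "p \<in> xi_polys r \<Longrightarrow> - p \<in> xi_polys r"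
  by (simp add: xi_polys_eq in_keys_iff)

lemma xi_polys_mult:
  assumes "p \<in> xi_polys r" "q \<in> xi_polys r"
  shows "p * q \<in> xi_polys r"
  unfolding xi_polys_eq
proof (intro CollectI ballI)
  fix m assume "m \<in> Poly_Mapping.keys (p * q)"
  then obtain a b where "m = a + b" "a \<in> Poly_Mapping.keys p" "b \<in> Poly_Mapping.keys q"
    using keys_mult[of p q] by auto
  then show "Poly_Mapping.keys m \<subseteq> {..<r}"
    using assms keys_add[of a b] unfolding xi_polys_eq by blast
qed

lemma xi_s_nonzero: "xi_s \<noteq> 0"
  by (metis lookup_single_eq lookup_zero xi_s_def zero_neq_one)

lemma xi_s_closed: "0 < r \<Longrightarrow> xi_s \<in> xi_polys r"
  by (simp add: xi_polys_eq xi_s_def)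

lemma xi_t_closed: "i < r \<Longrightarrow> xi_t i \<in> xi_polys r"
  by (simp add: xi_polys_eq xi_t_def)

lemma free_carrier_eq: "carrier (free_algebra r) = {f. \<forall>w. Poly_Mapping.lookup f w \<in> xi_polys r}"
  and free_simps [simp]:
    "monoid.mult (free_algebra r) = (*)" "one (free_algebra r) = 1" "ring.zero (free_algebra r) = 0" "add (free_algebra r) = (+)"
  by (simp_all add: free_algebra_def)

abbreviation free_carrier :: "nat \<Rightarrow> free set"
  where "free_carrier r \<equiv> carrier (free_algebra r)"

lemma term_of_closed: "c \<in> xi_polys r \<Longrightarrow> term_of c x \<in> free_carrier r"
  by (auto simp: free_carrier_eq term_of_def lookup_single when_def)

lemma free_add_closed: "F \<in> free_carrier r \<Longrightarrow> G \<in> free_carrier r \<Longrightarrow> F + G \<in> free_carrier r"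
  by (simp add: free_carrier_eq lookup_add xi_polys_add)

lemma free_uminus_closed: "F \<in> free_carrier r \<Longrightarrow> - F \<in> free_carrier r"
  by (simp add: free_carrier_eq xi_polys_uminus)

lemma free_diff_closed: "F \<in> free_carrier r \<Longrightarrow> G \<in> free_carrier r \<Longrightarrow> F - G \<in> free_carrier r"
  using free_add_closed[OF _ free_uminus_closed, of F r G] by simp

lemma free_0_closed: "0 \<in> free_carrier r"
  by (simp add: free_carrier_eq)

lemma free_1_closed: "1 \<in> free_carrier r"
  by (simp add: one_free term_of_closed)

lemma free_sum_closed: "(\<And>k. k \<in> A \<Longrightarrow> F k \<in> free_carrier r) \<Longrightarrow> sum F A \<in> free_carrier r"
  by (induction A rule: infinite_finite_induct) (auto intro: free_add_closed free_0_closed)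

lemma free_mult_closed:
  assumes "F \<in> free_carrier r" "G \<in> free_carrier r"
  shows "F * G \<in> free_carrier r"
proof -
  have "F * G = (\<Sum>v\<in>Poly_Mapping.keys F. \<Sum>w\<in>Poly_Mapping.keys G.
      term_of (Poly_Mapping.lookup F v * Poly_Mapping.lookup G w) (letters v @ letters w))"
    by (subst free_expand[of F], subst free_expand[of G]) (simp add: sum_product term_of_mult)
  moreover have "\<dots> \<in> free_carrier r"
    using assms by (intro free_sum_closed term_of_closed xi_polys_mult) (simp_all add: free_carrier_eq)
  ultimately show ?thesis by simp
qed

lemmas free_closed = term_of_closed free_add_closed free_uminus_closed free_diff_closed free_0_closed
  free_1_closed free_sum_closed free_mult_closed

lemma ring_free: "ring (free_algebra r)"
proof (rule ringI)
  show "abelian_group (free_algebra r)"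
    by (rule abelian_groupI) (auto intro: free_closed simp: algebra_simps intro!: bexI[of _ "- x" for x])
  show "monoid (free_algebra r)"
    by (rule monoidI) (auto intro: free_closed simp: mult.assoc)
qed (auto simp: algebra_simps)

lemma hecke_relators_closed:
  assumes "0 < r"
  shows "hecke_relators r \<subseteq> free_carrier r"
proof -
  have "xi_t i \<in> xi_polys r" if "i \<in> {1..r-1}" for i using that by (intro xi_t_closed) auto
  then show ?thesis
    unfolding hecke_relators_def using xi_s_closed[OF assms]
    by (auto intro!: free_closed)
qed

lemma free_minus: "F \<in> free_carrier r \<Longrightarrow> \<ominus>\<^bsub>free_algebra r\<^esub> F = - F"
proof -
  interpret ring "free_algebra r" by (rule ring_free)
  assume "F \<in> free_carrier r"
  then show ?thesis by (intro minus_equality) (simp_all add: free_uminus_closed)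
qed

lemma ideal_hecke: "0 < r \<Longrightarrow> ideal (hecke_ideal r) (free_algebra r)"
  unfolding hecke_ideal_def by (rule ring.genideal_ideal[OF ring_free hecke_relators_closed])

context
  fixes r :: nat
  assumes r: "0 < r"
begin

interpretation free: ring "free_algebra r" by (rule ring_free)
interpretation hideal: ideal "hecke_ideal r" "free_algebra r" by (rule ideal_hecke[OF r])

lemma hecke_ideal_closed: "F \<in> hecke_ideal r \<Longrightarrow> F \<in> free_carrier r"
  using hideal.a_subset by blast

lemma hecke_ideal_add: "F \<in> hecke_ideal r \<Longrightarrow> G \<in> hecke_ideal r \<Longrightarrow> F + G \<in> hecke_ideal r"
  using hideal.a_closed[of F G] by simp

lemma hecke_ideal_uminus: "F \<in> hecke_ideal r \<Longrightarrow> - F \<in> hecke_ideal r"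
  using hideal.a_inv_closed[of F] free_minus[OF hecke_ideal_closed] by simp

lemma hecke_ideal_diff: "F \<in> hecke_ideal r \<Longrightarrow> G \<in> hecke_ideal r \<Longrightarrow> F - G \<in> hecke_ideal r"
  using hecke_ideal_add[OF _ hecke_ideal_uminus, of F G] by simp

lemma hecke_ideal_lmult: "F \<in> hecke_ideal r \<Longrightarrow> G \<in> free_carrier r \<Longrightarrow> G * F \<in> hecke_ideal r"
  using hideal.I_l_closed[of F G] by simp

lemma hecke_ideal_rmult: "F \<in> hecke_ideal r \<Longrightarrow> G \<in> free_carrier r \<Longrightarrow> F * G \<in> hecke_ideal r"
  using hideal.I_r_closed[of F G] by simp

lemma hecke_relator_in_ideal: "F \<in> hecke_relators r \<Longrightarrow> F \<in> hecke_ideal r"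
  unfolding hecke_ideal_def using free.genideal_self[OF hecke_relators_closed[OF r]] by blast

lemma free_rep_hecke_ideal:
  assumes "F \<in> hecke_ideal r" "\<phi> \<in> rep_space r"
  shows "free_rep F \<phi> = (\<lambda>e i j. 0)"
proof -
  \<comment> \<open>The annihilator of the whole space, not of a single \<open>\<phi>\<close>: in a
    product the left factor moves \<open>\<phi>\<close> within \<open>rep_space r\<close>, and this
    makes \<open>K\<close> a two-sided ideal. It contains the relators, hence the ideal they
    generate.\<close>
  define K where "K = {F \<in> free_carrier r. \<forall>\<phi>\<in>rep_space r. free_rep F \<phi> = (\<lambda>e i j. 0)}"
  have "ideal K (free_algebra r)"
  proof (rule idealI[OF ring_free])
    show "subgroup K (add_monoid (free_algebra r))"
    proof (rule free.add.subgroupI)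
      show "K \<noteq> {}" by (auto simp: K_def free_0_closed fun_eq_iff intro!: exI[of _ 0])
      show "\<ominus>\<^bsub>free_algebra r\<^esub> F \<in> K" if "F \<in> K" for F
        using that free_rep_diff[of 0 F] by (auto simp: K_def free_minus free_uminus_closed fun_eq_iff)
      show "F \<oplus>\<^bsub>free_algebra r\<^esub> G \<in> K" if "F \<in> K" "G \<in> K" for F G
        using that by (auto simp: K_def free_add_closed free_rep_add fun_eq_iff)
    qed (auto simp: K_def)
    show "G \<otimes>\<^bsub>free_algebra r\<^esub> F \<in> K" "F \<otimes>\<^bsub>free_algebra r\<^esub> G \<in> K" if "F \<in> K" "G \<in> free_carrier r" for F G
      using that by (auto simp: K_def free_mult_closed free_rep_mult free_rep_of_zero free_rep_closed)
  qed
  moreover have "hecke_relators r \<subseteq> K"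
    using hecke_relators_closed[OF r] by (auto simp: K_def free_rep_relator fun_eq_iff)
  ultimately have "hecke_ideal r \<subseteq> K"
    unfolding hecke_ideal_def by (rule free.genideal_minimal)
  with assms show ?thesis by (auto simp: K_def)
qed

lemma hecke_class_eq: "hecke_class r F = {I + F | I. I \<in> hecke_ideal r}"
  by (auto simp: hecke_class_def a_r_coset_def r_coset_def)

lemma hecke_class_eqI:
  assumes "F - G \<in> hecke_ideal r"
  shows "hecke_class r F = hecke_class r G"
proof -
  have "\<exists>J. I + F = J + G \<and> J \<in> hecke_ideal r" if "I \<in> hecke_ideal r" for I
    using hecke_ideal_add[OF that assms] by (intro exI[of _ "I + (F - G)"]) simp
  moreover have "\<exists>J. I + G = J + F \<and> J \<in> hecke_ideal r" if "I \<in> hecke_ideal r" for I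
    using hecke_ideal_diff[OF that assms] by (intro exI[of _ "I - (F - G)"]) simp
  ultimately show ?thesis
    unfolding hecke_class_eq by blast
qed

lemma free_rep_hecke_class:
  assumes "hecke_class r F = hecke_class r G" "\<phi> \<in> rep_space r"
  shows "free_rep F \<phi> e i j = free_rep G \<phi> e i j"
proof -
  have "0 + F \<in> hecke_class r F" unfolding hecke_class_eq using hideal.zero_closed by auto
  then obtain I where "F = I + G" "I \<in> hecke_ideal r" using assms(1) unfolding hecke_class_eq[of G] by auto
  then show ?thesis using free_rep_hecke_ideal[OF _ assms(2)] by (simp add: free_rep_add)
qed

lemma hecke_simps:
  "carrier (hecke r) = hecke_class r ` free_carrier r"
  "\<one>\<^bsub>hecke r\<^esub> = hecke_class r 1"
  "F \<in> free_carrier r \<Longrightarrow> G \<in> free_carrier r \<Longrightarrow> hecke_class r F \<oplus>\<^bsub>hecke r\<^esub> hecke_class r G = hecke_class r (F + G)"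
  "F \<in> free_carrier r \<Longrightarrow> G \<in> free_carrier r \<Longrightarrow> hecke_class r F \<otimes>\<^bsub>hecke r\<^esub> hecke_class r G = hecke_class r (F * G)"
  "c \<in> xi_polys r \<Longrightarrow> F \<in> free_carrier r \<Longrightarrow> c \<odot>\<^bsub>hecke r\<^esub> hecke_class r F = hecke_class r (term_of c [] * F)"
proof -
  show "carrier (hecke r) = hecke_class r ` free_carrier r"
    by (auto simp: hecke_def Let_def FactRing_def A_RCOSETS_defs hecke_class_def a_r_coset_def)
qed (use hideal.rcoset_mult_add[of F G] hideal.a_rcos_sum[of F G] hideal.rcoset_mult_add[of "term_of c []" F]
  in \<open>simp_all add: hecke_def Let_def FactRing_def hecke_class_def term_of_closed\<close>)

lemma hecke_zero: "\<zero>\<^bsub>hecke r\<^esub> = hecke_class r 0"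
  by (simp add: hecke_def FactRing_def hecke_class_eq)

lemma abelian_group_hecke: "abelian_group (hecke r)"
proof (rule abelian_groupI)
  fix x assume "x \<in> carrier (hecke r)"
  then obtain F where F: "F \<in> free_carrier r" "x = hecke_class r F" by (auto simp: hecke_simps)
  then show "\<exists>y\<in>carrier (hecke r). y \<oplus>\<^bsub>hecke r\<^esub> x = \<zero>\<^bsub>hecke r\<^esub>"
    by (intro bexI[of _ "hecke_class r (- F)"]) (auto simp: hecke_simps hecke_zero free_uminus_closed)
qed (auto simp: hecke_simps hecke_zero free_0_closed free_add_closed add_ac)

interpretation H: abelian_group "hecke r" by (rule abelian_group_hecke)

lemma hecke_minus: "F \<in> free_carrier r \<Longrightarrow> \<ominus>\<^bsub>hecke r\<^esub> hecke_class r F = hecke_class r (- F)"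
  by (intro H.minus_equality) (auto simp: hecke_simps hecke_zero free_uminus_closed)

lemma hecke_finsum:
  "finite A \<Longrightarrow> (\<And>k. k \<in> A \<Longrightarrow> F k \<in> free_carrier r) \<Longrightarrow>
    (\<Oplus>\<^bsub>hecke r\<^esub>k\<in>A. hecke_class r (F k)) = hecke_class r (sum F A)"
proof (induction A rule: finite_induct)
  case (insert k A)
  then have "(\<lambda>k. hecke_class r (F k)) \<in> A \<rightarrow> carrier (hecke r)" by (auto simp: hecke_simps)
  with insert show ?case by (simp add: H.finsum_insert hecke_simps free_sum_closed)
qed (simp add: hecke_zero)

lemma T_basis_elem: "x \<in> basis_words r \<Longrightarrow> T_basis r (elem_of_word r x) = hecke_class r (term_of 1 x)"
  unfolding T_basis_def T_word_def
  by (rule arg_cong[of _ _ "\<lambda>x. hecke_class r (term_of 1 x)"], rule the_equality)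
    (auto dest: inj_onD[OF inj_on_basis_words])

text \<open>Carries expansions over group elements to sums over basis words in the free algebra,
  along the bijection between the two.\<close>

lemma expansion_iff:
  "expansion r h c \<longleftrightarrow> c \<in> carrier (Gr12 r) \<rightarrow> xi_polys r \<and>
    h = hecke_class r (\<Sum>x\<in>basis_words r. term_of (c (elem_of_word r x)) x)"
proof -
  have "(\<Oplus>\<^bsub>hecke r\<^esub>w\<in>carrier (Gr12 r). c w \<odot>\<^bsub>hecke r\<^esub> T_basis r w) =
     hecke_class r (\<Sum>x\<in>basis_words r. term_of (c (elem_of_word r x)) x)" if c: "c \<in> carrier (Gr12 r) \<rightarrow> xi_polys r"
  proof -
    have cx: "c (elem_of_word r x) \<in> xi_polys r" for x using c by auto
    have T: "c (elem_of_word r x) \<odot>\<^bsub>hecke r\<^esub> T_basis r (elem_of_word r x) =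
        hecke_class r (term_of (c (elem_of_word r x)) x)" if "x \<in> basis_words r" for x
      using that cx by (simp add: T_basis_elem hecke_simps term_of_closed term_of_mult)
    have cl: "hecke_class r (term_of (c (elem_of_word r x)) x) \<in> carrier (hecke r)" for x
      using cx by (simp add: hecke_simps term_of_closed)
    have "(\<Oplus>\<^bsub>hecke r\<^esub>w\<in>carrier (Gr12 r). c w \<odot>\<^bsub>hecke r\<^esub> T_basis r w) =
      (\<Oplus>\<^bsub>hecke r\<^esub>x\<in>basis_words r. c (elem_of_word r x) \<odot>\<^bsub>hecke r\<^esub> T_basis r (elem_of_word r x))"
      unfolding carrier_Gr12[OF r] using cl by (intro H.finsum_reindex inj_on_basis_words) (auto simp: T)
    also have "\<dots> = (\<Oplus>\<^bsub>hecke r\<^esub>x\<in>basis_words r. hecke_class r (term_of (c (elem_of_word r x)) x))"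
      by (rule H.finsum_cong') (auto simp: T cl)
    finally show ?thesis
      using cx by (simp add: hecke_finsum finite_basis_words term_of_closed)
  qed
  then show ?thesis
    unfolding expansion_def by (cases "c \<in> carrier (Gr12 r) \<rightarrow> xi_polys r") simp_all
qed

section \<open>Representatives supported on a given set of words\<close>

definition supported :: "gen list set \<Rightarrow> free set"
  where "supported W = {F \<in> free_carrier r. Poly_Mapping.keys F \<subseteq> Word ` W}"

lemma supportedD: "F \<in> supported W \<Longrightarrow> F \<in> free_carrier r"
  by (simp add: supported_def)

lemma supported_add: "F \<in> supported W \<Longrightarrow> G \<in> supported W \<Longrightarrow> F + G \<in> supported W"
  using keys_add[of F G] by (auto simp: supported_def free_add_closed)

lemma supported_uminus: "F \<in> supported W \<Longrightarrow> - F \<in> supported W"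
  by (auto simp: supported_def free_uminus_closed in_keys_iff)

lemma supported_mult:
  assumes "F \<in> supported V" "G \<in> supported W"
  shows "F * G \<in> supported {v @ w | v w. v \<in> V \<and> w \<in> W}"
proof -
  have "u \<in> Word ` {v @ w | v w. v \<in> V \<and> w \<in> W}" if "u \<in> Poly_Mapping.keys (F * G)" for u
  proof -
    from that keys_mult[of F G] obtain a b
      where ab: "u = a + b" "a \<in> Poly_Mapping.keys F" "b \<in> Poly_Mapping.keys G" by auto
    with assms obtain v w where "a = Word v" "b = Word w" "v \<in> V" "w \<in> W" unfolding supported_def by blast
    with ab(1) have "u = Word (v @ w)" by (simp add: plus_word_def)
    with \<open>v \<in> V\<close> \<open>w \<in> W\<close> show ?thesis by blast
  qed
  then show ?thesis
    using assms unfolding supported_def by (auto intro: free_mult_closed)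
qed

lemma supported_term_of: "c \<in> xi_polys r \<Longrightarrow> x \<in> W \<Longrightarrow> term_of c x \<in> supported W"
  by (auto simp: supported_def term_of_closed) (auto simp: term_of_def split: if_splits)

lemma supported_mono: "F \<in> supported V \<Longrightarrow> V \<subseteq> W \<Longrightarrow> F \<in> supported W"
  unfolding supported_def by blast

text \<open>Exponents of t stay unbounded, so products need no reduction by the relation of degree
  r. The dual functionals can be evaluated on all powers of t anyway.\<close>

lemma hecke_parabolic_subset: "hecke_parabolic r {gen_t} \<subseteq> hecke_class r ` supported (range tpow)"
proof
  fix h assume "h \<in> hecke_parabolic r {gen_t}"
  then show "h \<in> hecke_class r ` supported (range tpow)"
    unfolding hecke_parabolic_def
  proof induction
    case one
    have "[] \<in> range tpow" by (rule image_eqI[of _ _ 0]) auto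
    then show ?case by (simp add: hecke_simps one_free supported_term_of)
  next
    case (incl h)
    have "[] \<in> range tpow" "[gen_t] \<in> range tpow" by (auto intro: image_eqI[of _ _ 0] image_eqI[of _ _ 1])
    with incl show ?case
      by (auto simp: hecke_simps one_free T_word_def term_of_closed term_of_mult supported_term_of)
  next
    case (a_inv h)
    then show ?case by (auto simp: hecke_minus supportedD supported_uminus)
  next
    case (eng_add h1 h2)
    then show ?case by (auto simp: hecke_simps supportedD supported_add)
  next
    case (eng_mult h1 h2)
    then obtain F G where *: "h1 = hecke_class r F" "h2 = hecke_class r G" "F \<in> supported (range tpow)" "G \<in> supported (range tpow)"
      by blast
    have "F * G \<in> supported (range tpow)"
      using supported_mult[OF *(3,4)] by (rule supported_mono) (auto simp flip: tpow_add)
    with * show ?case by (simp add: hecke_simps supportedD)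
  qed
qed

lemma hecke_double_subset:
  assumes "d \<in> basis_words r"
  shows "hecke_double r {gen_t} (elem_of_word r d) \<subseteq>
    hecke_class r ` supported {tpow i @ d @ tpow j | i j. True}" (is "_ \<subseteq> _ ` supported ?W")
proof
  have gen: "h \<in> hecke_class r ` supported ?W"
    if "h \<in> {h \<otimes>\<^bsub>hecke r\<^esub> T_basis r (elem_of_word r d) \<otimes>\<^bsub>hecke r\<^esub> h' | h h'.
       h \<in> hecke_parabolic r {gen_t} \<and> h' \<in> hecke_parabolic r {gen_t}}" for h
  proof -
    from that obtain F G where FG: "F \<in> supported (range tpow)" "G \<in> supported (range tpow)"
      and h: "h = hecke_class r F \<otimes>\<^bsub>hecke r\<^esub> T_basis r (elem_of_word r d) \<otimes>\<^bsub>hecke r\<^esub> hecke_class r G"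
      using hecke_parabolic_subset by blast
    have "F * term_of 1 d * G \<in> supported ?W"
      using supported_mult[OF supported_mult[OF FG(1) supported_term_of[OF xi_polys_1 singletonI]] FG(2)]
      by (rule supported_mono) fastforce
    moreover have "h = hecke_class r (F * term_of 1 d * G)"
      unfolding h using FG by (simp add: T_basis_elem assms hecke_simps supportedD free_mult_closed term_of_closed)
    ultimately show ?thesis by blast
  qed
  fix h assume "h \<in> hecke_double r {gen_t} (elem_of_word r d)"
  then show "h \<in> hecke_class r ` supported ?W"
    unfolding hecke_double_def
  proof induction
    case one
    have "0 \<in> supported ?W" by (simp add: supported_def free_0_closed)
    then show ?case by (simp add: hecke_zero)
  next
    case (incl h)
    then show ?case by (rule gen)
  next
    case (inv h)
    from gen[OF inv] obtain F where "h = hecke_class r F" "F \<in> supported ?W" by blast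
    then show ?case using hecke_minus[OF supportedD] supported_uminus by (auto simp flip: a_inv_def)
  next
    case (eng h1 h2)
    then show ?case by (auto simp: hecke_simps supportedD supported_add)
  qed
qed

subsection \<open>Coefficients of elements of \<open>H\<^sub>J T\<^sub>d H\<^sub>J\<close>\<close>

text \<open>The functional depends only on the class of \<open>F\<close>, so it may be evaluated on
  the given representative or on the expansion.\<close>

lemma expansion_pairing:
  assumes "expansion r (hecke_class r F) c" "\<phi> \<in> rep_space r"
  shows "base_value (free_rep F \<phi>) = (\<Sum>x\<in>basis_words r. c (elem_of_word r x) * base_value (word_rep x \<phi>))"
proof -
  have "hecke_class r F = hecke_class r (\<Sum>x\<in>basis_words r. term_of (c (elem_of_word r x)) x)"
    using assms(1) by (simp add: expansion_iff)
  from free_rep_hecke_class[OF this assms(2)] show ?thesis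
    by (simp add: base_value_def free_rep_sum free_rep_term_of algebra_simps sum_subtractf sum_distrib_left)
qed

lemma supported_pairing:
  assumes "F \<in> supported W" "\<And>x. x \<in> W \<Longrightarrow> base_value (word_rep x \<phi>) = 0"
  shows "base_value (free_rep F \<phi>) = 0"
proof -
  have "base_value (free_rep F \<phi>) =
      (\<Sum>w\<in>Poly_Mapping.keys F. Poly_Mapping.lookup F w * base_value (word_rep (letters w) \<phi>))"
    by (simp add: base_value_def free_rep_def algebra_simps sum_subtractf sum_distrib_left)
  also have "\<dots> = 0"
    using assms unfolding supported_def by (intro sum.neutral) auto
  finally show ?thesis .
qed

text \<open>Evaluate one functional in two ways: it vanishes on the representative supported on
  \<open>W\<close>, while on the expansion it returns the coefficient at \<open>y\<close>. The last
  hypothesis admits nonzero values at basis words whose coefficients are already known to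
  vanish.\<close>

lemma expansion_coeff_zero:
  assumes "expansion r h c" "h \<in> hecke_class r ` supported W" "\<phi> \<in> rep_space r"
    and "\<And>x. x \<in> W \<Longrightarrow> base_value (word_rep x \<phi>) = 0"
    and "y \<in> basis_words r" "base_value (word_rep y \<phi>) = 1"
    and "\<And>x. x \<in> basis_words r \<Longrightarrow> x \<noteq> y \<Longrightarrow> c (elem_of_word r x) = 0 \<or> base_value (word_rep x \<phi>) = 0"
  shows "c (elem_of_word r y) = 0"
proof -
  obtain F where F: "h = hecke_class r F" "F \<in> supported W" using assms(2) by blast
  have "c (elem_of_word r y) = (\<Sum>x\<in>basis_words r. if x = y then c (elem_of_word r y) else 0)"
    using assms(5) by (simp add: finite_basis_words)
  also have "\<dots> = (\<Sum>x\<in>basis_words r. c (elem_of_word r x) * base_value (word_rep x \<phi>))"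
    using assms(6,7) by (intro sum.cong) auto
  also have "\<dots> = base_value (free_rep F \<phi>)"
    using expansion_pairing[of F c \<phi>] assms(1,3) F(1) by simp
  also have "\<dots> = 0" using supported_pairing[OF F(2) assms(4)] .
  finally show ?thesis .
qed

text \<open>Dual functions for the basis words with an even and with an odd number of letters \<open>s\<close>. In \<open>odd_dual\<close>
  the choice \<open>c = \<xi>\<^sub>s\<close> annihilates the powers of \<open>t\<close>, and \<open>c = 0\<close> annihilates the words \<open>t\<^sup>i s t s t\<^sup>j\<close>.\<close>

definition even_dual :: "nat \<Rightarrow> nat \<Rightarrow> rep"
  where "even_dual a b e i j = (if e then unit_seq r a i * unit_seq r b j else 0)"

definition odd_dual :: "poly_xi \<Rightarrow> nat \<Rightarrow> nat \<Rightarrow> rep"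
  where "odd_dual c a b e i j = (if e then c else 1) * (unit_seq r b i * unit_seq r a j)"

lemma even_dual_closed: "even_dual a b \<in> rep_space r"
proof -
  note u = unit_seq_recurrent[OF r]
  have "t_recurrent r (\<lambda>n. even_dual a b e n k)" "t_recurrent r (\<lambda>n. even_dual a b e k n)" for e k
    using t_recurrent_mult'[OF u] t_recurrent_mult[OF u] by (cases e; simp add: even_dual_def t_recurrent_zero)+
  then show ?thesis by (simp add: rep_space_def)
qed

lemma odd_dual_closed: "odd_dual c a b \<in> rep_space r"
proof -
  note u = unit_seq_recurrent[OF r]
  have "t_recurrent r (\<lambda>n. odd_dual c a b e n k)" "t_recurrent r (\<lambda>n. odd_dual c a b e k n)" for e k
    unfolding odd_dual_def by (intro t_recurrent_mult t_recurrent_mult' u)+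
  then show ?thesis by (simp add: rep_space_def)
qed

text \<open>The corrections made by t only involve values on the first summand, where
  \<open>even_dual\<close> is zero.\<close>

lemma word_rep_tpow_even_dual: "word_rep (tpow n) (even_dual a b) True i j = even_dual a b True (i + n) j"
  by (cases j) (simp_all add: word_rep_tpow_True_0 word_rep_tpow_True_Suc even_dual_def)

text \<open>Since s s is not a basis word, the index b = 0 belongs to t^a instead of t^a s t^b s.
  The functional is 1 at the word in question and 0 at every other basis word.\<close>

lemma even_coeff_zero:
  assumes "expansion r h c" "h \<in> hecke_class r ` supported W"
    and ab: "a < r" "b < r"
    and W: "\<And>x. x \<in> W \<Longrightarrow> base_value (word_rep x (even_dual a b)) = 0"
  shows "c (elem_of_word r (if b = 0 then tpow a else tpow a @ [gen_s] @ tpow b @ [gen_s])) = 0" (is "c (elem_of_word r ?y) = 0")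
proof (rule expansion_coeff_zero[OF assms(1,2) even_dual_closed W])
  have unit_0: "unit_seq r k 0 = (if k = 0 then 1 else 0)" for k using r by (auto simp: unit_seq_less)
  have tst: "base_value (word_rep (tpow i @ [gen_s] @ tpow j) (even_dual a b)) = 0" for i j
    unfolding base_value_t_s_t by (simp add: even_dual_def)
  have t: "base_value (word_rep (tpow i) (even_dual a b)) = (if i = a \<and> b = 0 then 1 else 0)" if "i < r" for i
    unfolding base_value_tpow using that by (simp add: even_dual_def unit_seq_less unit_0)
  have tsts: "base_value (word_rep (tpow i @ [gen_s] @ tpow j @ [gen_s]) (even_dual a b)) = (if i = a \<and> j = b then 1 else 0)"
    if "i < r" "j < r" for i j
    using base_value_t_s_t_s_t[of i j 0] that by (simp add: word_rep_tpow_even_dual even_dual_def unit_seq_less)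
  show "?y \<in> basis_words r"
    using ab unfolding basis_words_eq by (cases "b = 0") auto
  show "base_value (word_rep ?y (even_dual a b)) = 1"
    using t tsts ab by auto
  fix x assume "x \<in> basis_words r" "x \<noteq> ?y"
  from \<open>x \<in> basis_words r\<close> have "base_value (word_rep x (even_dual a b)) = 0"
    unfolding basis_words_eq
  proof (elim UnE CollectE exE conjE)
    fix i assume i: "x = tpow i" "i < r"
    with \<open>x \<noteq> ?y\<close> have "\<not> (i = a \<and> b = 0)" by (cases "b = 0") simp_all
    with i t show ?thesis by auto
  next
    fix i j assume i: "x = tpow i @ [gen_s] @ tpow j @ [gen_s]" "i < r" "1 \<le> j" "j < r"
    with \<open>x \<noteq> ?y\<close> have "\<not> (i = a \<and> j = b)" by auto
    with i tsts show ?thesis by auto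
  qed (use tst in auto)
  then show "c (elem_of_word r x) = 0 \<or> base_value (word_rep x (even_dual a b)) = 0" ..
qed

text \<open>Unlike \<open>even_dual\<close>, the functional can be nonzero on words with an even
  number of letters s. The assumptions \<open>t\<close> and \<open>tsts\<close> require that at each
  such basis word the value or the coefficient vanishes.\<close>

lemma odd_coeff_zero:
  assumes "expansion r h c" "h \<in> hecke_class r ` supported W"
    and ab: "a < r" "b < r"
    and W: "\<And>x. x \<in> W \<Longrightarrow> base_value (word_rep x (odd_dual \<kappa> a b)) = 0"
    and t: "\<And>i. i < r \<Longrightarrow> c (elem_of_word r (tpow i)) = 0 \<or> base_value (word_rep (tpow i) (odd_dual \<kappa> a b)) = 0"
    and tsts: "\<And>i j. i < r \<Longrightarrow> 1 \<le> j \<Longrightarrow> j < r \<Longrightarrow> c (elem_of_word r (tpow i @ [gen_s] @ tpow j @ [gen_s])) = 0 \<or>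
      base_value (word_rep (tpow i @ [gen_s] @ tpow j @ [gen_s]) (odd_dual \<kappa> a b)) = 0"
  shows "c (elem_of_word r (tpow a @ [gen_s] @ tpow b)) = 0" (is "c (elem_of_word r ?y) = 0")
proof (rule expansion_coeff_zero[OF assms(1,2) odd_dual_closed W])
  have tst: "base_value (word_rep (tpow i @ [gen_s] @ tpow j) (odd_dual \<kappa> a b)) = (if i = a \<and> j = b then 1 else 0)"
    if "i < r" "j < r" for i j
    unfolding base_value_t_s_t using that by (simp add: odd_dual_def unit_seq_less)
  show "?y \<in> basis_words r"
    using ab unfolding basis_words_eq by blast
  show "base_value (word_rep ?y (odd_dual \<kappa> a b)) = 1"
    using tst ab by simp
  fix x assume "x \<in> basis_words r" "x \<noteq> ?y"
  then consider i where "x = tpow i" "i < r" | i j where "x = tpow i @ [gen_s] @ tpow j" "i < r" "j < r" "\<not> (i = a \<and> j = b)"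
    | i j where "x = tpow i @ [gen_s] @ tpow j @ [gen_s]" "i < r" "1 \<le> j" "j < r"
    unfolding basis_words_eq by blast
  then show "c (elem_of_word r x) = 0 \<or> base_value (word_rep x (odd_dual \<kappa> a b)) = 0"
    using t tst tsts by cases auto
qed

text \<open>The element \<open>h\<close> has a representative supported on the words t^i d t^j. At
  each basis word outside the permitted double cosets, a dual functional that vanishes on all these
  words shows that the coefficient is zero.\<close>

lemma arrow_target:
  assumes d: "d \<in> {[], [gen_s]} \<union> {st_pow_s a | a. 1 \<le> a \<and> a \<le> r - 1}"
    and h: "h \<in> hecke_double r {gen_t} (elem_of_word r d)" and c: "expansion r h c"
    and x: "x \<in> basis_words r" "c (elem_of_word r x) \<noteq> 0"
  shows "elem_of_word r x \<in> dc_t r d \<or> (\<exists>a. d = st_pow_s a \<and> 2 \<le> a \<and> a \<le> r - 1 \<and> elem_of_word r x \<in> dc_t r [gen_s])"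
proof -
  let ?W = "{tpow i @ d @ tpow j | i j. True}"
  have tpow_basis: "tpow i \<in> basis_words r" if "i < r" for i using that unfolding basis_words_eq by blast
  have unit_0: "unit_seq r k 0 = (if k = 0 then 1 else 0)" for k using r by (auto simp: unit_seq_less)
  from d consider "d = []" | "d = [gen_s]" | a where "d = st_pow_s a" "1 \<le> a" "a < r" using r by fastforce
  then show ?thesis
  proof cases
    case 1
    then have "h \<in> hecke_class r ` supported ?W"
      using h hecke_double_subset[of "[]"] tpow_basis[of 0] r by auto
    note z = c this
    have W: "\<exists>n. y = tpow n" if "y \<in> ?W" for y using that 1 by (auto simp flip: tpow_add)
    have even: "c (elem_of_word r (tpow a @ [gen_s] @ tpow b @ [gen_s])) = 0" if "a < r" "1 \<le> b" "b < r" for a b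
    proof -
      have "base_value (word_rep y (even_dual a b)) = 0" if "y \<in> ?W" for y
        using W[OF that] \<open>1 \<le> b\<close> by (auto simp: base_value_tpow even_dual_def unit_0)
      from even_coeff_zero[OF z that(1,3) this] that(2) show ?thesis by simp
    qed
    have odd: "c (elem_of_word r (tpow a @ [gen_s] @ tpow b)) = 0" if "a < r" "b < r" for a b
    proof -
      have t: "base_value (word_rep (tpow n) (odd_dual xi_s a b)) = 0" for n
        by (simp add: base_value_tpow odd_dual_def)
      then have "base_value (word_rep y (odd_dual xi_s a b)) = 0" if "y \<in> ?W" for y
        using W[OF that] by auto
      from odd_coeff_zero[OF z that this] t even show ?thesis by blast
    qed
    from x even odd have "\<exists>a. x = tpow a" unfolding basis_words_eq by blast
    then show ?thesis using basis_word_dc_t(1)[OF r] 1 by auto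
  next
    case 2
    have "[gen_s] \<in> basis_words r"
      using r unfolding basis_words_eq by (auto intro!: exI[of _ 0])
    then have "h \<in> hecke_class r ` supported ?W"
      using h hecke_double_subset[of "[gen_s]"] 2 by blast
    note z = c this
    have even: "c (elem_of_word r (if b = 0 then tpow a else tpow a @ [gen_s] @ tpow b @ [gen_s])) = 0" if "a < r" "b < r" for a b
    proof -
      have "base_value (word_rep y (even_dual a b)) = 0" if "y \<in> ?W" for y
        using that 2 base_value_t_s_t by (auto simp: even_dual_def)
      from even_coeff_zero[OF z that this] show ?thesis .
    qed
    from x even[of _ 0] even have "\<exists>a b. x = tpow a @ [gen_s] @ tpow b"
      unfolding basis_words_eq using r by (auto split: if_splits) force+
    then show ?thesis using basis_word_dc_t(2)[OF r] 2 by auto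
  next
    case (3 a)
    have "tpow 0 @ [gen_s] @ tpow a @ [gen_s] \<in> basis_words r"
      using 3 r unfolding basis_words_eq by blast
    then have "h \<in> hecke_class r ` supported ?W"
      using h hecke_double_subset[of "st_pow_s a"] 3 by (auto simp: st_pow_s_def)
    note z = c this
    have W: "\<exists>i j. y = tpow i @ [gen_s] @ tpow a @ [gen_s] @ tpow j" if "y \<in> ?W" for y
      using that 3 by (auto simp: st_pow_s_def)
    have even: "c (elem_of_word r (if b = 0 then tpow a' else tpow a' @ [gen_s] @ tpow b @ [gen_s])) = 0"
      if "a' < r" "b < r" "b \<noteq> a" for a' b
    proof -
      \<comment> \<open>The value at t^i s t^a s t^j contains the factor
        \<open>unit_seq r b a\<close>, which is zero as a and b are different and less than
        r.\<close>
      have "base_value (word_rep y (even_dual a' b)) = 0" if "y \<in> ?W" for y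
        using W[OF that] base_value_t_s_t_s_t 3 \<open>b \<noteq> a\<close>
        by (auto simp: word_rep_tpow_even_dual even_dual_def unit_seq_less)
      from even_coeff_zero[OF z that(1,2) this] show ?thesis .
    qed
    have odd: "c (elem_of_word r (tpow a' @ [gen_s] @ tpow b)) = 0" if "a' < r" "b < r" "a = 1" for a' b
    proof -
      \<comment> \<open>For s t s the value is taken at second index 1, where the correction sum for
        t^i is empty; what remains carries the factor c = 0 of \<open>odd_dual\<close>.\<close>
      have tsts: "base_value (word_rep (tpow i @ [gen_s] @ tpow 1 @ [gen_s] @ tpow j) (odd_dual 0 a' b)) = 0" for i j
        unfolding base_value_t_s_t_s_t using word_rep_tpow_True_Suc[of i _ j 0] by (simp add: odd_dual_def)
      then have "base_value (word_rep y (odd_dual 0 a' b)) = 0" if "y \<in> ?W" for y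
        using W[OF that] \<open>a = 1\<close> by auto
      moreover have "c (elem_of_word r (tpow i)) = 0" if "i < r" for i
        using even[of i 0] that \<open>a = 1\<close> r by auto
      \<comment> \<open>The coefficient vanishes for j different from 1, the functional for j =
        1.\<close>
      moreover have "c (elem_of_word r (tpow i @ [gen_s] @ tpow j @ [gen_s])) = 0 \<or>
          base_value (word_rep (tpow i @ [gen_s] @ tpow j @ [gen_s]) (odd_dual 0 a' b)) = 0"
        if "i < r" "1 \<le> j" "j < r" for i j
        using even[of i j] that \<open>a = 1\<close> tsts[of i 0] by (cases "j = 1") auto
      ultimately show ?thesis using odd_coeff_zero[OF z that(1,2)] by blast
    qed
    from x(1) consider i where "x = tpow i" "i < r" | i j where "x = tpow i @ [gen_s] @ tpow j" "i < r" "j < r"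
      | i j where "x = tpow i @ [gen_s] @ tpow j @ [gen_s]" "i < r" "1 \<le> j" "j < r"
      unfolding basis_words_eq by blast
    then show ?thesis
    proof cases
      case 1
      then show ?thesis using even[of i 0] 3 r x(2) by auto
    next
      case 2
      then have "a \<noteq> 1" using odd x(2) by blast
      then show ?thesis using 2 3 basis_word_dc_t(2)[OF r] by auto
    next
      case sts: 3
      then have "j = a" using even[of i j] x(2) by (cases "j = a") auto
      then show ?thesis using 3 sts basis_word_dc_t(3)[OF r] by auto
    qed
  qed
qed

subsection \<open>The arrows\<close>

lemma sts_tpow_commute:
  "term_of 1 [gen_s, gen_t, gen_s] * term_of 1 (tpow a) - term_of 1 (tpow a) * term_of 1 [gen_s, gen_t, gen_s]
    \<in> hecke_ideal r"
proof (induction a)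
  case 0
  then show ?case using hideal.zero_closed by (simp add: term_of_mult)
next
  case (Suc a)
  define b t p :: free where "b = term_of 1 [gen_s, gen_t, gen_s]" "t = term_of 1 [gen_t]" "p = term_of 1 (tpow a)"
  have closed: "t \<in> free_carrier r" "p \<in> free_carrier r" by (simp_all add: b_t_p_def term_of_closed)
  have "b * t - t * b \<in> hecke_relators r" by (simp add: b_t_p_def term_of_mult hecke_relators_def)
  then have "b * t - t * b \<in> hecke_ideal r" by (rule hecke_relator_in_ideal)
  moreover have "b * p - p * b \<in> hecke_ideal r" using Suc unfolding b_t_p_def .
  \<comment> \<open>The commutator of b with p t expands as [b, p] t + p [b, t], and [b, t] is the
    braid relator.\<close>
  ultimately have "(b * p - p * b) * t + p * (b * t - t * b) \<in> hecke_ideal r"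
    using closed by (intro hecke_ideal_add hecke_ideal_rmult[of "b * p - p * b"] hecke_ideal_lmult)
  moreover have "term_of 1 (tpow (Suc a)) = p * t"
    by (simp add: b_t_p_def term_of_mult replicate_append_same)
  ultimately show ?case unfolding b_t_p_def[symmetric] by (simp add: algebra_simps)
qed

text \<open>Since \<open>T\<^sub>s - \<xi>\<^sub>s\<close> is the inverse of \<open>T\<^sub>s\<close>, this is \<open>T\<^sub>s T\<^sub>t T\<^sub>s T\<^sub>t\<^sup>a = T\<^sub>t\<^sup>a T\<^sub>s T\<^sub>t T\<^sub>s\<close> multiplied by
  it on both sides.\<close>

lemma st_pow_s_t:
  "hecke_class r (term_of 1 (st_pow_s a @ [gen_t])) = hecke_class r (term_of 1 ([gen_t] @ st_pow_s a)
    - term_of xi_s ([gen_t, gen_s] @ tpow a) + term_of xi_s (tpow a @ [gen_s, gen_t]))"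
proof (rule hecke_class_eqI)
  define s t p x :: free where
    "s = term_of 1 [gen_s]" "t = term_of 1 [gen_t]" "p = term_of 1 (tpow a)" "x = term_of xi_s []"
  \<comment> \<open>Modulo the quadratic relator \<open>q\<close>, the element \<open>y\<close> is a
    two-sided inverse of \<open>s\<close>. Multiplying the commutator \<open>e\<close> by
    \<open>y\<close> on both sides strips one \<open>s\<close> from each of its terms.\<close>
  define y q e where "y = s - x" and "q = s * s - (1 + x * s)" and "e = s * t * s * p - p * s * t * s"
  have closed: "s \<in> free_carrier r" "t \<in> free_carrier r" "p \<in> free_carrier r" "y \<in> free_carrier r"
    using xi_s_closed[OF r] by (auto simp: y_def s_t_p_x_def intro!: free_closed)
  have q: "q \<in> hecke_ideal r"
    by (rule hecke_relator_in_ideal) (simp add: q_def s_t_p_x_def term_of_mult hecke_relators_def)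
  have e: "e \<in> hecke_ideal r"
    using sts_tpow_commute[of a] by (simp add: e_def s_t_p_x_def term_of_mult)
  have x: "s * x = x * s" "t * s * p * x = x * (t * s * p)"
    by (simp_all add: s_t_p_x_def term_of_mult)
  have ys: "y * s = q + 1" "s * y = q + 1"
    using x(1) by (simp_all add: y_def q_def algebra_simps)
  have "y * e * y = (y * s) * (t * s * p * y) - (y * p * s * t) * (s * y)"
    by (simp add: e_def algebra_simps)
  also have "\<dots> = q * (t * s * p * y) - (y * p * s * t) * q - (y * p * s * t - t * s * p * y)"
    unfolding ys by (simp add: algebra_simps)
  finally have "y * p * s * t - t * s * p * y = q * (t * s * p * y) - (y * p * s * t) * q - y * e * y"
    by (simp add: algebra_simps)
  also have "\<dots> \<in> hecke_ideal r"
    using q e closed by (intro hecke_ideal_diff hecke_ideal_lmult hecke_ideal_rmult free_mult_closed)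
  also have "y * p * s * t - t * s * p * y =
      s * p * s * t - (t * s * p * s - x * (t * s * p) + x * (p * s * t))"
    using x(2) by (simp add: y_def algebra_simps)
  also have "\<dots> = term_of 1 (st_pow_s a @ [gen_t]) - (term_of 1 ([gen_t] @ st_pow_s a)
    - term_of xi_s ([gen_t, gen_s] @ tpow a) + term_of xi_s (tpow a @ [gen_s, gen_t]))"
    by (simp add: s_t_p_x_def term_of_mult st_pow_s_def)
  finally show "\<dots> \<in> hecke_ideal r" .
qed

lemma tpow_in_hecke_parabolic: "hecke_class r (term_of 1 (tpow j)) \<in> hecke_parabolic r {gen_t}"
  unfolding hecke_parabolic_def
proof (induction j)
  case 0
  then show ?case using generate_ring.one[of "hecke r"] by (simp add: hecke_simps one_free)
next
  case (Suc j)
  have "hecke_class r (term_of 1 [gen_t]) \<otimes>\<^bsub>hecke r\<^esub> hecke_class r (term_of 1 (tpow j)) \<in>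
      generate_ring (hecke r) ((\<lambda>c. c \<odot>\<^bsub>hecke r\<^esub> \<one>\<^bsub>hecke r\<^esub>) ` xi_polys r \<union> (\<lambda>x. T_word r [x]) ` {gen_t})"
    using Suc by (intro generate_ring.eng_mult generate_ring.incl[of "hecke_class r (term_of 1 [gen_t])"])
      (simp_all add: T_word_def)
  then show ?case by (simp add: hecke_simps term_of_closed term_of_mult)
qed

lemma word_in_hecke_double:
  assumes "d \<in> basis_words r"
  shows "hecke_class r (term_of 1 (tpow i @ d @ tpow j)) \<in> hecke_double r {gen_t} (elem_of_word r d)"
proof -
  have "hecke_class r (term_of 1 (tpow i @ d @ tpow j)) =
      hecke_class r (term_of 1 (tpow i)) \<otimes>\<^bsub>hecke r\<^esub> T_basis r (elem_of_word r d) \<otimes>\<^bsub>hecke r\<^esub> hecke_class r (term_of 1 (tpow j))"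
    by (simp add: T_basis_elem assms hecke_simps term_of_closed term_of_mult)
  then show ?thesis
    unfolding hecke_double_def using tpow_in_hecke_parabolic by (intro generate.incl) blast
qed

text \<open>An arrow asks for some expansion with a nonzero coefficient, so it suffices to exhibit
  coefficients on basis words and transport them to the group by the inverse bijection.\<close>

lemma dc_arrow_wordI:
  assumes "min_length_elems r D = {elem_of_word r d}" "h \<in> hecke_double r {gen_t} (elem_of_word r d)"
    and f: "\<And>x. f x \<in> xi_polys r"
    and h: "h = hecke_class r (\<Sum>x\<in>basis_words r. term_of (f x) x)"
    and x: "x \<in> basis_words r" "elem_of_word r x \<in> D'" "f x \<noteq> 0"
  shows "dc_arrow r {gen_t} D D'"
proof -
  define c where "c w = f (the_inv_into (basis_words r) (elem_of_word r) w)" for w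
  have c: "c (elem_of_word r x) = f x" if "x \<in> basis_words r" for x
    using that by (simp add: c_def the_inv_into_f_f inj_on_basis_words)
  have "(\<Sum>x\<in>basis_words r. term_of (c (elem_of_word r x)) x) = (\<Sum>x\<in>basis_words r. term_of (f x) x)"
    by (intro sum.cong HOL.refl) (simp only: c)
  then have "expansion r h c"
    unfolding expansion_iff h using f by (simp add: c_def)
  moreover have "elem_of_word r x \<in> D'" "c (elem_of_word r x) \<noteq> 0"
    using x by (simp_all add: c)
  ultimately show ?thesis
    unfolding dc_arrow_def using assms(1,2) by (metis singletonI)
qed

lemma rep_words_basis:
  assumes "d \<in> {[], [gen_s]} \<union> {st_pow_s a | a. 1 \<le> a \<and> a \<le> r - 1}"
  shows "d \<in> basis_words r"
proof -
  have "tpow 0 \<in> basis_words r" "tpow 0 @ [gen_s] @ tpow 0 \<in> basis_words r"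
    using r unfolding basis_words_eq by blast+
  moreover have "tpow 0 @ [gen_s] @ tpow a @ [gen_s] \<in> basis_words r" if "1 \<le> a" "a \<le> r - 1" for a
  proof -
    have "a < r" using that by linarith
    then show ?thesis using that(1) r unfolding basis_words_eq by blast
  qed
  ultimately show ?thesis using assms by (auto simp: st_pow_s_def)
qed

lemma dc_arrow_loop:
  assumes "d \<in> {[], [gen_s]} \<union> {st_pow_s a | a. 1 \<le> a \<and> a \<le> r - 1}"
  shows "dc_arrow r {gen_t} (dc_t r d) (dc_t r d)"
proof (rule dc_arrow_wordI[OF min_length_dc_t[OF r assms]])
  have d: "d \<in> basis_words r" using assms by (rule rep_words_basis)
  show "hecke_class r (term_of 1 d) \<in> hecke_double r {gen_t} (elem_of_word r d)"
    using word_in_hecke_double[OF d, of 0 0] by simp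
  have "(\<Sum>x\<in>basis_words r. term_of (if x = d then 1 else 0) x) = (\<Sum>x\<in>basis_words r. if x = d then term_of 1 d else 0)"
    by (intro sum.cong) (auto simp: term_of_def)
  then show "hecke_class r (term_of 1 d) = hecke_class r (\<Sum>x\<in>basis_words r. term_of (if x = d then 1 else 0) x)"
    using d by (simp add: finite_basis_words)
  show "d \<in> basis_words r" by fact
  show "elem_of_word r d \<in> dc_t r d" using elem_in_dc_t[OF r, of 0 d 0] by simp
qed auto

lemma dc_arrow_st_pow_s:
  assumes "2 \<le> a" "a \<le> r - 1"
  shows "dc_arrow r {gen_t} (dc_t r (st_pow_s a)) (dc_t r [gen_s])"
proof -
  have d: "st_pow_s a \<in> {[], [gen_s]} \<union> {st_pow_s a | a. 1 \<le> a \<and> a \<le> r - 1}"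
    using assms by auto
  have lt: "1 \<le> a" "a < r" "1 < r" using assms by auto
  \<comment> \<open>The three basis words in the expansion of T_s T_t^a T_s T_t given by
    \<open>st_pow_s_t\<close>.\<close>
  define x1 x2 x3 where x: "x1 = tpow 1 @ [gen_s] @ tpow a @ [gen_s]" "x2 = tpow 1 @ [gen_s] @ tpow a"
    "x3 = tpow a @ [gen_s] @ tpow 1"
  have basis: "x1 \<in> basis_words r" "x2 \<in> basis_words r" "x3 \<in> basis_words r"
    using lt unfolding x basis_words_eq by blast+
  \<comment> \<open>Here a \<ge> 2 is used: for a = 1 the words \<open>x2\<close> and
    \<open>x3\<close> coincide and their coefficients cancel.\<close>
  have "x3 ! 1 = gen_t" "x2 ! 1 = gen_s" using assms(1) by (simp_all add: x nth_append nth_Cons')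
  then have "x2 \<noteq> x3" by (metis gen.distinct(1))
  moreover have "x2 \<noteq> x1" by (simp add: x)
  ultimately have ne: "x2 \<noteq> x1" "x2 \<noteq> x3" by simp_all
  define f where "f y = (if y = x1 then 1 else 0) + (if y = x2 then - xi_s else 0) + (if y = x3 then xi_s else 0)" for y
  have add: "term_of (c + d) y = term_of c y + term_of d y" for c d y by (simp add: term_of_def single_add)
  have if_0: "term_of (if P then c else 0) y = (if P then term_of c y else 0)" for P c y by (simp add: term_of_def)
  have "(\<Sum>y\<in>basis_words r. term_of (f y) y) = term_of 1 x1 + term_of (- xi_s) x2 + term_of xi_s x3"
    using basis by (simp add: f_def add if_0 sum.distrib finite_basis_words)
  also have "term_of (- xi_s) x2 = - term_of xi_s x2" by (simp add: term_of_def single_uminus)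
  finally have sum: "hecke_class r (\<Sum>y\<in>basis_words r. term_of (f y) y) = hecke_class r (term_of 1 (st_pow_s a @ [gen_t]))"
    unfolding st_pow_s_t by (simp add: x st_pow_s_def)
  show ?thesis
  proof (rule dc_arrow_wordI[OF min_length_dc_t[OF r d] _ _ sum[symmetric] basis(2)])
    show "hecke_class r (term_of 1 (st_pow_s a @ [gen_t])) \<in> hecke_double r {gen_t} (elem_of_word r (st_pow_s a))"
      using word_in_hecke_double[OF rep_words_basis[OF d], of 0 1] by simp
    show "f y \<in> xi_polys r" for y
      unfolding f_def using xi_s_closed[OF r] by (intro xi_polys_add) (auto intro: xi_polys_uminus)
    show "elem_of_word r x2 \<in> dc_t r [gen_s]" unfolding x by (rule basis_word_dc_t(2)[OF r])
    show "f x2 \<noteq> 0" using ne by (simp add: f_def xi_s_nonzero)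
  qed
qed

lemma dc_arrow_cases:
  assumes D: "D \<in> double_coset r {gen_t} ` carrier (Gr12 r)" and D': "D' \<in> double_coset r {gen_t} ` carrier (Gr12 r)"
    and arrow: "dc_arrow r {gen_t} D D'"
  shows "D = D' \<or> (\<exists>a. 2 \<le> a \<and> a \<le> r - 1 \<and> D = dc_t r (st_pow_s a) \<and> D' = dc_t r [gen_s])"
proof -
  obtain d d' where d: "d \<in> {[], [gen_s]} \<union> {st_pow_s a | a. 1 \<le> a \<and> a \<le> r - 1}" "D = dc_t r d" and d': "D' = dc_t r d'"
    using D D' unfolding double_cosets_t[OF r] by blast
  \<comment> \<open>The minimal length element is unique, so the representative chosen in the arrow
    must be the one given by \<open>d\<close>.\<close>
  from arrow obtain h c w where *: "h \<in> hecke_double r {gen_t} (elem_of_word r d)" "expansion r h c" "w \<in> D'" "c w \<noteq> 0"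
    unfolding dc_arrow_def d(2) min_length_dc_t[OF r d(1)] by blast
  have "w \<in> carrier (Gr12 r)" using *(3) unfolding d' dc_t_eq[OF r] by auto
  then obtain x where x: "x \<in> basis_words r" "w = elem_of_word r x" unfolding carrier_Gr12[OF r] by blast
  have "elem_of_word r x \<in> dc_t r d \<or> (\<exists>a. d = st_pow_s a \<and> 2 \<le> a \<and> a \<le> r - 1 \<and> elem_of_word r x \<in> dc_t r [gen_s])"
    using arrow_target[OF d(1) *(1,2) x(1)] *(4) x(2) by simp
  then show ?thesis
    using dc_t_cong[OF r, of w d'] *(3) unfolding d(2) d' x(2) by metis
qed

end

theorem proposition4p5:
  fixes r :: nat
  assumes "r \<ge> 2"
  shows
    "pverts (dc_graph r {gen_t}) =
       {dc_t r [], dc_t r [gen_s]} \<union> {dc_t r (st_pow_s a) | a. 1 \<le> a \<and> a \<le> r - 1} \<and>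
     card (pverts (dc_graph r {gen_t})) = r + 1 \<and>
     (\<forall>x \<in> {[], [gen_s]} \<union> {st_pow_s a | a. 1 \<le> a \<and> a \<le> r - 1}.
       min_length_elems r (dc_t r x) = {elem_of_word r x}) \<and>
     parcs (dc_graph r {gen_t}) =
       {(D, D) | D. D \<in> pverts (dc_graph r {gen_t})} \<union>
       {(dc_t r (st_pow_s a), dc_t r [gen_s]) | a. 2 \<le> a \<and> a \<le> r - 1} \<and>
     terminal_vertex (dc_graph r {gen_t}) (dc_t r []) \<and>
     terminal_vertex (dc_graph r {gen_t}) (dc_t r [gen_s]) \<and>
     terminal_vertex (dc_graph r {gen_t}) (dc_t r (st_pow_s 1))"
proof -
  have r: "0 < r" using assms by simp
  let ?V = "double_coset r {gen_t} ` carrier (Gr12 r)"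
  have verts: "pverts (dc_graph r {gen_t}) = ?V"
    and arcs: "parcs (dc_graph r {gen_t}) = {(D, D'). D \<in> ?V \<and> D' \<in> ?V \<and> dc_arrow r {gen_t} D D'}"
    by (simp_all add: dc_graph_def Let_def)
  note V = double_cosets_t[OF r]
  have loop: "dc_arrow r {gen_t} D D" if "D \<in> ?V" for D
    using that dc_arrow_loop[OF r] unfolding V by blast
  have st: "dc_t r (st_pow_s a) \<in> ?V" if "1 \<le> a" "a \<le> r - 1" for a
    using that unfolding V by blast
  have s: "dc_t r [gen_s] \<in> ?V" "dc_t r [] \<in> ?V"
    unfolding V by blast+
  have arcs': "parcs (dc_graph r {gen_t}) = {(D, D) | D. D \<in> ?V} \<union>
       {(dc_t r (st_pow_s a), dc_t r [gen_s]) | a. 2 \<le> a \<and> a \<le> r - 1}" (is "_ = ?R")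
  proof
    show "parcs (dc_graph r {gen_t}) \<subseteq> ?R"
      unfolding arcs
    proof (rule subsetI, elim CollectE case_prodE conjE)
      fix p D D' assume "p = (D, D')" "D \<in> ?V" "D' \<in> ?V" "dc_arrow r {gen_t} D D'"
      then show "p \<in> ?R" using dc_arrow_cases[OF r, of D D'] by blast
    qed
    show "?R \<subseteq> parcs (dc_graph r {gen_t})"
      unfolding arcs using loop st s dc_arrow_st_pow_s[OF r] by auto
  qed
  \<comment> \<open>Arrows other than loops start only at the double cosets of s t^a s with a \<ge>
    2, so it is enough to differ from all of these.\<close>
  have terminal: "terminal_vertex (dc_graph r {gen_t}) D"
    if "D \<in> ?V" "\<And>a. 2 \<le> a \<Longrightarrow> a \<le> r - 1 \<Longrightarrow> D \<noteq> dc_t r (st_pow_s a)" for D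
    using that unfolding terminal_vertex_def verts arcs' by blast
  have 1: "1 \<le> r - 1" using assms by simp
  have "terminal_vertex (dc_graph r {gen_t}) (dc_t r [])"
    using s(2) dc_t_distinct(2)[OF r] r by (intro terminal) auto
  moreover have "terminal_vertex (dc_graph r {gen_t}) (dc_t r [gen_s])"
    using s(1) dc_t_distinct(3)[OF r] by (intro terminal) auto
  moreover have "terminal_vertex (dc_graph r {gen_t}) (dc_t r (st_pow_s 1))"
  proof (rule terminal)
    show "dc_t r (st_pow_s 1) \<noteq> dc_t r (st_pow_s a)" if "2 \<le> a" "a \<le> r - 1" for a
    proof -
      have "1 < r" "a < r" "1 \<noteq> a" using that assms by linarith+
      then show ?thesis using dc_t_distinct(4)[OF r, of 1 a] by blast
    qed
  qed (use st[OF _ 1] in simp)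
  ultimately show ?thesis
    using card_double_cosets_t[OF r] min_length_dc_t[OF r] arcs'
    unfolding verts by (intro conjI ballI V) assumption+
qed

end
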